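(* Let $G=\mathbb F_2$ be the free group on two generators, and let $G_0=\mathbb F_2$ and $G_{n+1}=G_n^{(2)}$ for $n\ge0$, where $K^{(2)}$ denotes the subgroup of a group $K$ generated by the squares of all elements of $K$. For the sequence of finite index normal subgroups $G\supset G_1\supset G_2\supset\cdots$ there exists $\gamma\in Z$ with $\lim_{n\to\infty}\gamma_n=\infty$ and $\lim_{n\to\infty}\frac{\gamma_n}{|G/G_n|}=0$ such that $\pi_\gamma$ weakly contains the trivial representation of $G$.
   Context: For a residually finite group $G$ with finite index normal subgroups $G\supset G_1\supset G_2\supset\cdots$, strictly decreasing, with $\cap_{n\in\mathbb N}G_n=\{e\}$ (this holds for the subgroups in the claim), put $X_n=G/G_n$ (a finite group on which $G$ acts by left translation, $(g,x)\mapsto gx$) and $\nu_n=|X_n|$. Let $l^2(X_n)$ be the finite-dimensional Hilbert space with respect to counting measure on $X_n$, and let $\lambda_n$ be the quasi-regular representation of $G$ on $l^2(X_n)$, $(\lambda_n(g)\xi)(x)=\xi(g^{-1}x)$. Fix a non-principal ultrafilter $\mathcal U$ on $\mathbb N$. Let $\widetilde H=\{\xi=(\xi_n)_{n\in\mathbb N}:\xi_n\in l^2(X_n),\ \sup_n\|\xi_n\|<\infty\}$ with the sesquilinear form $\langle\xi,\eta\rangle=\lim_{\mathcal U}\langle\xi_n,\eta_n\rangle$, let $\widetilde H_0=\{\xi\in\widetilde H:\langle\xi,\xi\rangle=0\}$, and let $\widehat H$ be the Hilbert space completion of $\widetilde H/\widetilde H_0$. The formula $\widehat\lambda(g)(\xi_n)_{n}=(\lambda_n(g)\xi_n)_{n}$,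 $g\in G$, defines a unitary representation $\widehat\lambda$ of $G$ on $\widehat H$. Let $Z$ be the set of all non-decreasing integer-valued sequences $\gamma=(\gamma_n)_{n\in\mathbb N}$ with $1\le\gamma_n\le\nu_n$ for all $n$ (growth functions). For $\gamma\in Z$ and $k\in\mathbb N$ let $\widetilde H^{(k)}_\gamma\subset\widetilde H$ be the set of all sequences $(\xi_n)$ with $|\operatorname{supp}\xi_n|\le k\gamma_n$ for each $n$; let $\widetilde H_\gamma=\cup_{k=1}^\infty\widetilde H^{(k)}_\gamma$ (a linear subspace), and let $H_\gamma$ be the closure of $(\widetilde H_\gamma+\widetilde H_0)/\widetilde H_0$ in $\widehat H$. The subspace $H_\gamma$ is invariant under $\widehat\lambda$, and $\pi_\gamma=\widehat\lambda|_{H_\gamma}$. Representations of $G$ are extended linearly to $\mathbb C[G]$. A unitary representation $\pi$ is weakly contained in $\sigma$ (equivalently, $\sigma$ weakly contains $\pi$) if $\|\pi(a)\|\le\|\sigma(a)\|$ for all $a\in\mathbb C[G]$. *)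

theory Defs
  imports Complex_Main "HOL-Library.Extended_Real" "HOL-Algebra.Module" "HOL-Algebra.AbelCoset"
    "HOL-Algebra.Generated_Groups"
begin

section \<open>Free groups and the series of subgroups generated by squares\<close>

text \<open>A letter \<open>(s, True)\<close> stands for the generator \<open>s\<close> and \<open>(s, False)\<close> for its inverse;
  elements of the free group are the reduced words.\<close>

type_synonym 's letter = "'s \<times> bool"

definition inv_letter :: "'s letter \<Rightarrow> 's letter" where
  "inv_letter x = (fst x, \<not> snd x)"

definition reduced :: "'s letter list \<Rightarrow> bool" where
  "reduced w \<longleftrightarrow> successively (\<lambda>x y. y \<noteq> inv_letter x) w"

fun push :: "'s letter \<Rightarrow> 's letter list \<Rightarrow> 's letter list" where
  "push x [] = [x]"
| "push x (y # w) = (if y = inv_letter x then w else x # y # w)"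

definition free_group :: "'s set \<Rightarrow> 's letter list monoid" where
  "free_group S = \<lparr>carrier = {w. fst ` set w \<subseteq> S \<and> reduced w},
                   monoid.mult = (\<lambda>u v. foldr push u v), one = []\<rparr>"

definition F2 :: "bool letter list monoid" where
  "F2 = free_group UNIV"

lemma inv_letter_inv_letter [simp]: "inv_letter (inv_letter x) = x"
  by (simp add: inv_letter_def)

lemma fst_inv_letter [simp]: "fst (inv_letter x) = fst x"
  by (simp add: inv_letter_def)

lemma push_cancel: "reduced w \<Longrightarrow> push x (push (inv_letter x) w) = w"
proof (cases w)
  case (Cons y ys)
  assume "reduced w"
  then show ?thesis
    using Cons by (cases ys) (auto simp: reduced_def)
qed simp

lemma reduced_push: "reduced w \<Longrightarrow> reduced (push x w)"
  by (cases w) (auto simp: reduced_def successively_Cons)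

lemma reduced_foldr_push: "reduced w \<Longrightarrow> reduced (foldr push u w)"
  by (induction u) (auto simp: reduced_push)

lemma set_push: "fst ` set (push x w) \<subseteq> insert (fst x) (fst ` set w)"
  by (cases w) auto

lemma set_foldr_push: "fst ` set (foldr push u w) \<subseteq> fst ` set u \<union> fst ` set w"
proof (induction u)
  case (Cons a u)
  then show ?case
    using subset_trans[OF set_push[of a "foldr push u w"] insert_mono[OF Cons.IH]] by simp
qed simp

lemma foldr_push_push: "reduced w \<Longrightarrow> foldr push (push x u) w = push x (foldr push u w)"
  by (cases u) (auto simp: push_cancel reduced_foldr_push)

lemma foldr_push_assoc:
  "reduced w \<Longrightarrow> foldr push (foldr push u v) w = foldr push u (foldr push v w)"
  by (induction u) (auto simp: foldr_push_push)

lemma foldr_push_Nil: "reduced u \<Longrightarrow> foldr push u [] = u"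
proof (induction u)
  case (Cons a u)
  then show ?case by (cases u) (auto simp: reduced_def)
qed simp

lemma foldr_push_inverse:
  "reduced w \<Longrightarrow> foldr push (rev (map inv_letter u)) (foldr push u w) = w"
proof (induction u)
  case (Cons a u)
  then show ?case
    using push_cancel[of "foldr push u w" "inv_letter a"] by (simp add: reduced_foldr_push)
qed simp

lemma reduced_rev_map_inv_letter: "reduced w \<Longrightarrow> reduced (rev (map inv_letter w))"
  unfolding reduced_def successively_rev successively_map
  by (erule successively_mono) (metis inv_letter_inv_letter)

lemma group_free_group: "group (free_group S)"
proof (rule groupI)
  fix u assume u: "u \<in> carrier (free_group S)"
  have "rev (map inv_letter u) \<in> carrier (free_group S)"
    using u by (auto simp: free_group_def reduced_rev_map_inv_letter)
  moreover have "rev (map inv_letter u) \<otimes>\<^bsub>free_group S\<^esub> u = \<one>\<^bsub>free_group S\<^esub>"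
    using u foldr_push_inverse[of "[]" u]
    by (simp add: free_group_def foldr_push_Nil reduced_def)
  ultimately show "\<exists>v\<in>carrier (free_group S). v \<otimes>\<^bsub>free_group S\<^esub> u = \<one>\<^bsub>free_group S\<^esub>"
    by blast
next
  fix u v assume uv: "u \<in> carrier (free_group S)" "v \<in> carrier (free_group S)"
  then have "fst ` set (foldr push u v) \<subseteq> S"
    using subset_trans[OF set_foldr_push[of u v], of S] by (simp add: free_group_def)
  with uv show "u \<otimes>\<^bsub>free_group S\<^esub> v \<in> carrier (free_group S)"
    by (simp add: free_group_def reduced_foldr_push)
next
  show "\<one>\<^bsub>free_group S\<^esub> \<in> carrier (free_group S)"
    by (simp add: free_group_def reduced_def)
qed (auto simp: free_group_def foldr_push_assoc)

lemma group_F2: "group F2"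
  unfolding F2_def by (rule group_free_group)

definition squares_subgroup :: "('g, 'm) monoid_scheme \<Rightarrow> 'g set \<Rightarrow> 'g set" where
  "squares_subgroup G K = generate G ((\<lambda>x. x \<otimes>\<^bsub>G\<^esub> x) ` K)"

primrec squares_series :: "('g, 'm) monoid_scheme \<Rightarrow> nat \<Rightarrow> 'g set" where
  "squares_series G 0 = carrier G"
| "squares_series G (Suc n) = squares_subgroup G (squares_series G n)"


section \<open>Complex vector spaces with a semi-inner product\<close>

text \<open>The fields \<open>mult\<close> and \<open>one\<close>, which the record of modules inherits from rings,
  play no role.  Semi-inner products are linear in the first argument.\<close>

record 'v ip_space = "(complex, 'v) module" +
  ip :: "'v \<Rightarrow> 'v \<Rightarrow> complex"

definition ip_norm :: "('v, 'm) ip_space_scheme \<Rightarrow> 'v \<Rightarrow> real" where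
  "ip_norm H v = sqrt (Re (ip H v v))"

definition ip_dist :: "('v, 'm) ip_space_scheme \<Rightarrow> 'v \<Rightarrow> 'v \<Rightarrow> real" where
  "ip_dist H v w = ip_norm H (v \<ominus>\<^bsub>H\<^esub> w)"

definition ip_closure :: "('v, 'm) ip_space_scheme \<Rightarrow> 'v set \<Rightarrow> 'v set" where
  "ip_closure H S = {v \<in> carrier H. \<forall>e>0. \<exists>w\<in>S. ip_dist H v w < e}"

text \<open>Extended-real valued, so that unbounded operators have norm \<open>\<infinity>\<close>.\<close>

definition op_norm :: "('v, 'm) ip_space_scheme \<Rightarrow> ('v \<Rightarrow> 'v) \<Rightarrow> ereal" where
  "op_norm H T = (SUP v \<in> {v \<in> carrier H. ip_norm H v \<le> 1}. ereal (ip_norm H (T v)))"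

definition null_space :: "('v, 'm) ip_space_scheme \<Rightarrow> 'v set" where
  "null_space H = {v \<in> carrier H. ip H v v = 0}"

text \<open>The quotient by the null space.  Operations on cosets are computed on representatives.\<close>

definition sep_class :: "('v, 'm) ip_space_scheme \<Rightarrow> 'v \<Rightarrow> 'v set" where
  "sep_class H v = null_space H +>\<^bsub>H\<^esub> v"

definition sep_map :: "('v, 'm) ip_space_scheme \<Rightarrow> ('v \<Rightarrow> 'v) \<Rightarrow> 'v set \<Rightarrow> 'v set" where
  "sep_map H T A = sep_class H (T (SOME v. v \<in> A))"

definition sep_quotient :: "('v, 'm) ip_space_scheme \<Rightarrow> 'v set ip_space" where
  "sep_quotient H = \<lparr>carrier = a_rcosets\<^bsub>H\<^esub> (null_space H), monoid.mult = undefined, one = undefined,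
     ring.zero = null_space H, ring.add = set_add H,
     module.smult = (\<lambda>c. sep_map H (smult H c)),
     ip = (\<lambda>A B. ip H (SOME v. v \<in> A) (SOME w. w \<in> B))\<rparr>"

text \<open>The completion: Cauchy sequences modulo null sequences.\<close>

definition cauchy_space :: "('v, 'm) ip_space_scheme \<Rightarrow> (nat \<Rightarrow> 'v) ip_space" where
  "cauchy_space H = \<lparr>carrier = {x. (\<forall>k. x k \<in> carrier H) \<and>
         (\<forall>e>0. \<exists>M. \<forall>m\<ge>M. \<forall>n\<ge>M. ip_dist H (x m) (x n) < e)},
     monoid.mult = undefined, one = undefined,
     ring.zero = (\<lambda>k. \<zero>\<^bsub>H\<^esub>), ring.add = (\<lambda>x y k. x k \<oplus>\<^bsub>H\<^esub> y k),
     module.smult = (\<lambda>c x k. c \<odot>\<^bsub>H\<^esub> x k),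
     ip = (\<lambda>x y. lim (\<lambda>k. ip H (x k) (y k)))\<rparr>"

definition completion :: "('v, 'm) ip_space_scheme \<Rightarrow> (nat \<Rightarrow> 'v) set ip_space" where
  "completion H = sep_quotient (cauchy_space H)"

definition completion_emb :: "('v, 'm) ip_space_scheme \<Rightarrow> 'v \<Rightarrow> (nat \<Rightarrow> 'v) set" where
  "completion_emb H v = sep_class (cauchy_space H) (\<lambda>k. v)"

definition completion_map ::
  "('v, 'm) ip_space_scheme \<Rightarrow> ('v \<Rightarrow> 'v) \<Rightarrow> (nat \<Rightarrow> 'v) set \<Rightarrow> (nat \<Rightarrow> 'v) set" where
  "completion_map H T = sep_map (cauchy_space H) (\<lambda>x k. T (x k))"


section \<open>Weak containment\<close>

definition group_algebra :: "('g, 'm) monoid_scheme \<Rightarrow> ('g \<Rightarrow> complex) set" where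
  "group_algebra G = {a. finite {g. a g \<noteq> 0} \<and> {g. a g \<noteq> 0} \<subseteq> carrier G}"

definition rep_extend ::
  "('v, 'm) ip_space_scheme \<Rightarrow> ('g \<Rightarrow> 'v \<Rightarrow> 'v) \<Rightarrow> ('g \<Rightarrow> complex) \<Rightarrow> 'v \<Rightarrow> 'v" where
  "rep_extend H \<pi> a v = (\<Oplus>\<^bsub>H\<^esub>g\<in>{g. a g \<noteq> 0}. a g \<odot>\<^bsub>H\<^esub> \<pi> g v)"

text \<open>The representation \<open>\<sigma>\<close> on \<open>K\<close> weakly contains the representation \<open>\<pi>\<close> on \<open>H\<close>.\<close>

definition weakly_contains ::
  "('g, 'k) monoid_scheme \<Rightarrow> ('w, 'n) ip_space_scheme \<Rightarrow> ('g \<Rightarrow> 'w \<Rightarrow> 'w) \<Rightarrow>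
     ('v, 'm) ip_space_scheme \<Rightarrow> ('g \<Rightarrow> 'v \<Rightarrow> 'v) \<Rightarrow> bool" where
  "weakly_contains G K \<sigma> H \<pi> \<longleftrightarrow>
     (\<forall>a\<in>group_algebra G. op_norm H (rep_extend H \<pi> a) \<le> op_norm K (rep_extend K \<sigma> a))"

definition complex_line :: "complex ip_space" where
  "complex_line = \<lparr>carrier = UNIV, monoid.mult = undefined, one = undefined,
     ring.zero = 0, ring.add = (+),
     module.smult = (*), ip = (\<lambda>z w. z * cnj w)\<rparr>"

definition trivial_rep :: "'g \<Rightarrow> complex \<Rightarrow> complex" where
  "trivial_rep g z = z"


section \<open>The representations attached to a decreasing sequence of subgroups\<close>

definition nonprincipal_ultrafilter :: "nat filter \<Rightarrow> bool" where
  "nonprincipal_ultrafilter U \<longleftrightarrow> U \<noteq> bot \<and>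
     (\<forall>P. eventually P U \<or> eventually (\<lambda>n. \<not> P n) U) \<and> (\<forall>m. eventually (\<lambda>n. n \<noteq> m) U)"

text \<open>\<open>l\<^sup>2(X)\<close> for a finite set \<open>X\<close>; functions on \<open>X\<close> are extended by zero.\<close>

definition l2 :: "'x set \<Rightarrow> ('x \<Rightarrow> complex) ip_space" where
  "l2 X = \<lparr>carrier = {\<xi>. \<forall>x. x \<notin> X \<longrightarrow> \<xi> x = 0}, monoid.mult = undefined, one = undefined,
     ring.zero = (\<lambda>x. 0), ring.add = (\<lambda>\<xi> \<eta> x. \<xi> x + \<eta> x),
     module.smult = (\<lambda>c \<xi> x. c * \<xi> x),
     ip = (\<lambda>\<xi> \<eta>. \<Sum>x\<in>X. \<xi> x * cnj (\<eta> x))\<rparr>"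

text \<open>Bounded sequences with the ultralimit of the inner products, before separation.\<close>

definition bounded_sequences :: "nat filter \<Rightarrow> (nat \<Rightarrow> 'v ip_space) \<Rightarrow> (nat \<Rightarrow> 'v) ip_space" where
  "bounded_sequences U K = \<lparr>carrier = {\<xi>. (\<forall>n. \<xi> n \<in> carrier (K n)) \<and>
         bdd_above (range (\<lambda>n. ip_norm (K n) (\<xi> n)))},
     monoid.mult = undefined, one = undefined,
     ring.zero = (\<lambda>n. \<zero>\<^bsub>K n\<^esub>), ring.add = (\<lambda>\<xi> \<eta> n. \<xi> n \<oplus>\<^bsub>K n\<^esub> \<eta> n),
     module.smult = (\<lambda>c \<xi> n. c \<odot>\<^bsub>K n\<^esub> \<xi> n),
     ip = (\<lambda>\<xi> \<eta>. Lim U (\<lambda>n. ip (K n) (\<xi> n) (\<eta> n)))\<rparr>"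

text \<open>In what follows \<open>N\<close> is a sequence of normal subgroups of finite index of a group \<open>G\<close>.
  The elements of \<^term>\<open>carrier (G Mod N n)\<close> are right cosets in the library, but for normal
  subgroups these are the left cosets, and \<open>G\<close> acts on them by \<open>(g, x) \<mapsto> g <# x\<close>.\<close>

definition coset_space :: "('g, 'm) monoid_scheme \<Rightarrow> (nat \<Rightarrow> 'g set) \<Rightarrow> nat \<Rightarrow> 'g set set" where
  "coset_space G N n = carrier (G Mod N n)"

definition quasi_regular ::
  "('g, 'm) monoid_scheme \<Rightarrow> (nat \<Rightarrow> 'g set) \<Rightarrow> nat \<Rightarrow> 'g \<Rightarrow> ('g set \<Rightarrow> complex) \<Rightarrow> 'g set \<Rightarrow> complex"
  where
  "quasi_regular G N n g \<xi> =
     (\<lambda>x. if x \<in> coset_space G N n then \<xi> (inv\<^bsub>G\<^esub> g <#\<^bsub>G\<^esub> x) else 0)"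

definition H_tilde ::
  "('g, 'm) monoid_scheme \<Rightarrow> (nat \<Rightarrow> 'g set) \<Rightarrow> nat filter \<Rightarrow> (nat \<Rightarrow> 'g set \<Rightarrow> complex) ip_space"
  where
  "H_tilde G N U = bounded_sequences U (\<lambda>n. l2 (coset_space G N n))"

definition H_hat ::
  "('g, 'm) monoid_scheme \<Rightarrow> (nat \<Rightarrow> 'g set) \<Rightarrow> nat filter \<Rightarrow>
     (nat \<Rightarrow> (nat \<Rightarrow> 'g set \<Rightarrow> complex) set) set ip_space"
  where
  "H_hat G N U = completion (sep_quotient (H_tilde G N U))"

definition H_hat_emb ::
  "('g, 'm) monoid_scheme \<Rightarrow> (nat \<Rightarrow> 'g set) \<Rightarrow> nat filter \<Rightarrow> (nat \<Rightarrow> 'g set \<Rightarrow> complex) \<Rightarrow>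
     (nat \<Rightarrow> (nat \<Rightarrow> 'g set \<Rightarrow> complex) set) set"
  where
  "H_hat_emb G N U \<xi> =
     completion_emb (sep_quotient (H_tilde G N U)) (sep_class (H_tilde G N U) \<xi>)"

definition lambda_hat ::
  "('g, 'm) monoid_scheme \<Rightarrow> (nat \<Rightarrow> 'g set) \<Rightarrow> nat filter \<Rightarrow> 'g \<Rightarrow>
     (nat \<Rightarrow> (nat \<Rightarrow> 'g set \<Rightarrow> complex) set) set \<Rightarrow>
     (nat \<Rightarrow> (nat \<Rightarrow> 'g set \<Rightarrow> complex) set) set"
  where
  "lambda_hat G N U g =
     completion_map (sep_quotient (H_tilde G N U))
       (sep_map (H_tilde G N U) (\<lambda>\<xi> n. quasi_regular G N n g (\<xi> n)))"

definition growth_functions ::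
  "('g, 'm) monoid_scheme \<Rightarrow> (nat \<Rightarrow> 'g set) \<Rightarrow> (nat \<Rightarrow> nat) set" where
  "growth_functions G N = {\<gamma>. mono \<gamma> \<and> (\<forall>n. 1 \<le> \<gamma> n \<and> \<gamma> n \<le> card (coset_space G N n))}"

definition H_tilde_growth ::
  "('g, 'm) monoid_scheme \<Rightarrow> (nat \<Rightarrow> 'g set) \<Rightarrow> nat filter \<Rightarrow> (nat \<Rightarrow> nat) \<Rightarrow>
     (nat \<Rightarrow> 'g set \<Rightarrow> complex) set"
  where
  "H_tilde_growth G N U \<gamma> =
     (\<Union>k\<in>{1..}. {\<xi> \<in> carrier (H_tilde G N U). \<forall>n. card {x. \<xi> n x \<noteq> 0} \<le> k * \<gamma> n})"

definition H_growth ::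
  "('g, 'm) monoid_scheme \<Rightarrow> (nat \<Rightarrow> 'g set) \<Rightarrow> nat filter \<Rightarrow> (nat \<Rightarrow> nat) \<Rightarrow>
     (nat \<Rightarrow> (nat \<Rightarrow> 'g set \<Rightarrow> complex) set) set ip_space"
  where
  "H_growth G N U \<gamma> = (H_hat G N U)
     \<lparr>carrier := ip_closure (H_hat G N U) (H_hat_emb G N U ` H_tilde_growth G N U \<gamma>)\<rparr>"

definition pi_growth ::
  "('g, 'm) monoid_scheme \<Rightarrow> (nat \<Rightarrow> 'g set) \<Rightarrow> nat filter \<Rightarrow> (nat \<Rightarrow> nat) \<Rightarrow> 'g \<Rightarrow>
     (nat \<Rightarrow> (nat \<Rightarrow> 'g set \<Rightarrow> complex) set) set \<Rightarrow>
     (nat \<Rightarrow> (nat \<Rightarrow> 'g set \<Rightarrow> complex) set) set"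
  where
  "pi_growth G N U \<gamma> g = restrict (lambda_hat G N U g) (carrier (H_growth G N U \<gamma>))"

end

theory Submission
  imports Defs
begin

text \<open>
  Let \<open>e\<close> be the exponent sum of the first generator, a homomorphism from the free group \<open>F\<close> onto the
  integers, and let \<open>G\<^sub>n\<close> be the \<open>n\<close>-th subgroup of the series.  Squaring doubles \<open>e\<close>, so \<open>e\<close> maps
  \<open>G\<^sub>n\<close> into the multiples of \<open>2\<^sup>n\<close>, and \<open>e\<close> modulo \<open>2\<^sup>n\<close> is a homomorphism from the finite group
  \<open>X\<^sub>n = F / G\<^sub>n\<close> onto the integers modulo \<open>2\<^sup>n\<close>.  Its fibres, here called levels, all have the same
  size.  Let \<open>A\<^sub>n\<close> consist of the cosets whose level lies in the interval from \<open>0\<close> to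
  \<open>2\<close>\<open>\<^bsup>n div 2\<^esup> - 1\<close>.  Left translation by \<open>g\<close> shifts levels by \<open>e g\<close>, which alters the membership in
  the interval for a number of levels that is bounded independently of \<open>n\<close>, whereas the interval grows.
  So the \<open>A\<^sub>n\<close> are Folner sets, although their proportion in \<open>X\<^sub>n\<close>, which is \<open>2\<close>\<open>\<^bsup>n div 2 - n\<^esup>\<close>,
  tends to \<open>0\<close>.  The growth function is \<open>\<gamma>\<^sub>n = |A\<^sub>n|\<close>.

  The normalised indicator functions of the \<open>A\<^sub>n\<close> are unit vectors supported on \<open>\<gamma>\<^sub>n\<close> points, and any
  \<open>g\<close> moves them by an amount that tends to \<open>0\<close>.  In the ultraproduct they become one unit vector
  \<open>v\<close> of \<open>H\<^sub>\<gamma>\<close> that is genuinely fixed by every \<open>g\<close>.  Then \<open>\<pi>\<^sub>\<gamma>(a) v\<close> is the sum of the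
  coefficients of \<open>a\<close> times \<open>v\<close>, so that the norm of \<open>\<pi>\<^sub>\<gamma>(a)\<close> is at least the absolute value of
  that sum, which is the norm of \<open>a\<close> in the trivial representation.  This is
  \<open>folner_sets_imp_weakly_contains_trivial\<close>.

  Two points need an argument on the side of groups.  The \<open>X\<^sub>n\<close> are finite because a subgroup of finite
  index in a finitely generated group is finitely generated, and a finitely generated group of exponent
  two is finite (\<open>finite_index_squares_subgroup\<close>).  The function \<open>\<gamma>\<close> is non-decreasing because
  level \<open>0\<close> of \<open>X\<^bsub>n+1\<^esub>\<close> maps onto level \<open>0\<close> of \<open>X\<^sub>n\<close> (\<open>mono_level_size\<close>).  Nothing here is special to
  the free group: the argument works for any finitely generated group with a homomorphism onto the
  integers.

  On the side of Hilbert spaces, the ultraproduct, the separation and the completion are each shown to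
  produce semi-inner product spaces, and operators are carried through them by a Lipschitz condition.
\<close>

section \<open>Semi-inner product spaces\<close>

text \<open>The common ground of all the spaces that occur: \<open>l\<^sup>2\<close> spaces, their ultraproduct before and
  after separation, the space of Cauchy sequences and the completion.  The form may be degenerate, as
  it is before each separation.\<close>
locale semi_ip_space = abelian_group H
  for H :: "('v, 'm) ip_space_scheme" (structure) +
  assumes smult_closed [simp]: "v \<in> carrier H \<Longrightarrow> c \<odot> v \<in> carrier H"
    and smult_r_distr:
      "\<lbrakk>v \<in> carrier H; w \<in> carrier H\<rbrakk> \<Longrightarrow> c \<odot> (v \<oplus> w) = c \<odot> v \<oplus> c \<odot> w"
    and smult_l_distr: "v \<in> carrier H \<Longrightarrow> (c + d) \<odot> v = c \<odot> v \<oplus> d \<odot> v"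
    and smult_assoc: "v \<in> carrier H \<Longrightarrow> (c * d) \<odot> v = c \<odot> (d \<odot> v)"
    and smult_one [simp]: "v \<in> carrier H \<Longrightarrow> 1 \<odot> v = v"
    and ip_add: "\<lbrakk>u \<in> carrier H; v \<in> carrier H; w \<in> carrier H\<rbrakk>
      \<Longrightarrow> ip H (u \<oplus> v) w = ip H u w + ip H v w"
    and ip_smult: "\<lbrakk>v \<in> carrier H; w \<in> carrier H\<rbrakk> \<Longrightarrow> ip H (c \<odot> v) w = c * ip H v w"
    and ip_commute: "\<lbrakk>v \<in> carrier H; w \<in> carrier H\<rbrakk> \<Longrightarrow> ip H w v = cnj (ip H v w)"
    and ip_ge_0: "v \<in> carrier H \<Longrightarrow> 0 \<le> Re (ip H v v)"
begin

lemma ip_zero [simp]: "w \<in> carrier H \<Longrightarrow> ip H \<zero> w = 0"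
  using ip_add[of \<zero> \<zero> w] by simp

lemma ip_uminus: "\<lbrakk>v \<in> carrier H; w \<in> carrier H\<rbrakk> \<Longrightarrow> ip H (\<ominus> v) w = - ip H v w"
  using ip_add[of "\<ominus> v" v w] by (simp add: l_neg eq_neg_iff_add_eq_0)

lemma ip_diff: "\<lbrakk>u \<in> carrier H; v \<in> carrier H; w \<in> carrier H\<rbrakk>
    \<Longrightarrow> ip H (u \<ominus> v) w = ip H u w - ip H v w"
  by (simp add: a_minus_def ip_add ip_uminus)

lemma ip_diff_right: "\<lbrakk>u \<in> carrier H; v \<in> carrier H; w \<in> carrier H\<rbrakk>
    \<Longrightarrow> ip H w (u \<ominus> v) = ip H w u - ip H w v"
  using ip_commute[of "u \<ominus> v" w] ip_commute[of u w] ip_commute[of v w]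
  by (simp add: ip_diff)

lemma ip_add_right: "\<lbrakk>u \<in> carrier H; v \<in> carrier H; w \<in> carrier H\<rbrakk>
    \<Longrightarrow> ip H w (u \<oplus> v) = ip H w u + ip H w v"
  using ip_commute[of "u \<oplus> v" w] ip_commute[of u w] ip_commute[of v w]
  by (simp add: ip_add)

lemma ip_smult_right: "\<lbrakk>v \<in> carrier H; w \<in> carrier H\<rbrakk> \<Longrightarrow> ip H w (c \<odot> v) = cnj c * ip H w v"
  using ip_commute[of "c \<odot> v" w] ip_commute[of v w] by (simp add: ip_smult)

lemma ip_self: "v \<in> carrier H \<Longrightarrow> ip H v v = complex_of_real ((ip_norm H v)\<^sup>2)"
  using ip_commute[of v v] ip_ge_0[of v]
  by (simp add: complex_eq_iff ip_norm_def)

lemma ip_norm_ge_0 [simp]: "v \<in> carrier H \<Longrightarrow> 0 \<le> ip_norm H v"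
  by (simp add: ip_norm_def ip_ge_0)

lemma ip_norm_zero [simp]: "ip_norm H \<zero> = 0"
  by (simp add: ip_norm_def)

lemma ip_norm_smult: "v \<in> carrier H \<Longrightarrow> ip_norm H (c \<odot> v) = cmod c * ip_norm H v"
proof -
  assume v: "v \<in> carrier H"
  have "ip H (c \<odot> v) (c \<odot> v) = (c * cnj c) * ip H v v"
    using v by (simp add: ip_smult ip_smult_right)
  also have "\<dots> = complex_of_real ((cmod c * ip_norm H v)\<^sup>2)"
    using v by (simp add: ip_self power_mult_distrib flip: complex_norm_square)
  finally show ?thesis
    using v by (simp add: ip_norm_def[of H "c \<odot> v"])
qed

lemma Cauchy_Schwarz:
  assumes v: "v \<in> carrier H" and w: "w \<in> carrier H"
  shows "cmod (ip H v w) \<le> ip_norm H v * ip_norm H w"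
proof -
  define c where "c = ip H v w"
  \<comment> \<open>Expand the square of the norm of \<open>v - r\<langle>v, w\<rangle>w\<close>; the form may be degenerate, so \<open>w\<close> can have
    norm \<open>0\<close> without being \<open>0\<close>, in which case a large \<open>r\<close> gives the claim.\<close>
  have key: "0 \<le> (ip_norm H v)\<^sup>2 - 2 * r * (cmod c)\<^sup>2 + r\<^sup>2 * (cmod c)\<^sup>2 * (ip_norm H w)\<^sup>2" for r :: real
  proof -
    define t where "t = complex_of_real r * c"
    have wv: "ip H w v = cnj c"
      using ip_commute[OF v w] by (simp add: c_def)
    have "ip H (v \<ominus> t \<odot> w) (v \<ominus> t \<odot> w)
        = ip H v v - cnj t * c - t * cnj c + t * cnj t * ip H w w"
      using v w by (simp add: ip_diff ip_diff_right ip_smult ip_smult_right wv c_def algebra_simps)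
    also have "\<dots> = ip H v v - 2 * r * (c * cnj c) + r\<^sup>2 * (c * cnj c) * ip H w w"
      by (simp add: t_def algebra_simps power2_eq_square)
    also have "\<dots> = complex_of_real
        ((ip_norm H v)\<^sup>2 - 2 * r * (cmod c)\<^sup>2 + r\<^sup>2 * (cmod c)\<^sup>2 * (ip_norm H w)\<^sup>2)"
      using v w by (simp add: ip_self flip: complex_norm_square)
    finally show ?thesis
      using ip_ge_0[of "v \<ominus> t \<odot> w"] v w by simp
  qed
  show ?thesis
  proof (cases "ip_norm H w = 0")
    case True
    have "cmod c = 0"
    proof (rule ccontr)
      assume "cmod c \<noteq> 0"
      then show False
        using key[of "((ip_norm H v)\<^sup>2 + 1) / (cmod c)\<^sup>2"] True
          zero_le_power2[of "ip_norm H v"] by simp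
    qed
    then show ?thesis
      using True by (simp add: c_def)
  next
    case False
    then have pos: "(ip_norm H w)\<^sup>2 > 0"
      by simp
    have "0 \<le> (ip_norm H v)\<^sup>2 - (cmod c)\<^sup>2 / (ip_norm H w)\<^sup>2"
      using key[of "1 / (ip_norm H w)\<^sup>2"] False by (simp add: power2_eq_square)
    then have "(cmod c)\<^sup>2 \<le> (ip_norm H v * ip_norm H w)\<^sup>2"
      using pos by (simp add: pos_divide_le_eq power_mult_distrib)
    then show ?thesis
      unfolding c_def by (rule power2_le_imp_le) (simp add: v w)
  qed
qed

lemma ip_norm_triangle:
  assumes v: "v \<in> carrier H" and w: "w \<in> carrier H"
  shows "ip_norm H (v \<oplus> w) \<le> ip_norm H v + ip_norm H w"
proof -
  have "ip H (v \<oplus> w) (v \<oplus> w) = ip H v v + ip H v w + (cnj (ip H v w) + ip H w w)"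
    using v w ip_commute[OF v w] by (simp only: ip_add ip_add_right a_closed) simp
  then have "(ip_norm H (v \<oplus> w))\<^sup>2 = (ip_norm H v)\<^sup>2 + 2 * Re (ip H v w) + (ip_norm H w)\<^sup>2"
    using v w by (simp add: ip_self complex_eq_iff)
  also have "\<dots> \<le> (ip_norm H v + ip_norm H w)\<^sup>2"
    using complex_Re_le_cmod[of "ip H v w"] Cauchy_Schwarz[OF v w] by (simp add: power2_sum)
  finally show ?thesis
    by (rule power2_le_imp_le) (simp add: v w)
qed

lemma ip_dist_ge_0 [simp]: "\<lbrakk>v \<in> carrier H; w \<in> carrier H\<rbrakk> \<Longrightarrow> 0 \<le> ip_dist H v w"
  by (simp add: ip_dist_def)

lemma ip_dist_self [simp]: "v \<in> carrier H \<Longrightarrow> ip_dist H v v = 0"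
  by (simp add: ip_dist_def a_minus_def r_neg)

lemma smult_minus_one: "v \<in> carrier H \<Longrightarrow> (- 1) \<odot> v = \<ominus> v"
proof -
  assume v: "v \<in> carrier H"
  have "0 \<odot> v \<oplus> 0 \<odot> v = 0 \<odot> v"
    using v smult_l_distr[of v 0 0] by simp
  then have "0 \<odot> v = \<zero>"
    using v add.l_cancel_one' by (metis smult_closed)
  then have "(- 1) \<odot> v \<oplus> v = \<zero>"
    using v smult_l_distr[of v "- 1" 1] by simp
  then show ?thesis
    using v by (simp add: minus_equality[symmetric])
qed

lemma smult_zero: "v \<in> carrier H \<Longrightarrow> 0 \<odot> v = \<zero>"
  using smult_l_distr[of v "- 1" 1] by (simp add: smult_minus_one l_neg)

lemma smult_uminus: "v \<in> carrier H \<Longrightarrow> c \<odot> (\<ominus> v) = \<ominus> (c \<odot> v)"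
  using smult_assoc[of v c "- 1"] smult_assoc[of v "- 1" c] by (simp add: smult_minus_one)

lemma smult_diff: "\<lbrakk>v \<in> carrier H; w \<in> carrier H\<rbrakk> \<Longrightarrow> c \<odot> (v \<ominus> w) = c \<odot> v \<ominus> c \<odot> w"
  by (simp add: a_minus_def smult_r_distr smult_uminus)

lemma ip_dist_smult:
  "\<lbrakk>v \<in> carrier H; w \<in> carrier H\<rbrakk> \<Longrightarrow> ip_dist H (c \<odot> v) (c \<odot> w) = cmod c * ip_dist H v w"
  using ip_norm_smult[of "v \<ominus> w" c] by (simp add: ip_dist_def smult_diff)

lemma ip_dist_add:
  assumes "u \<in> carrier H" "v \<in> carrier H" "w \<in> carrier H" "z \<in> carrier H"
  shows "ip_dist H (u \<oplus> v) (w \<oplus> z) \<le> ip_dist H u w + ip_dist H v z"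
proof -
  have "(u \<oplus> v) \<ominus> (w \<oplus> z) = (u \<ominus> w) \<oplus> (v \<ominus> z)"
    using assms by (simp add: a_minus_def minus_add a_ac)
  then show ?thesis
    using assms ip_norm_triangle[of "u \<ominus> w" "v \<ominus> z"] by (simp add: ip_dist_def)
qed

lemma ip_norm_diff_le:
  assumes "v \<in> carrier H" "w \<in> carrier H"
  shows "ip_norm H v \<le> ip_norm H w + ip_dist H v w"
proof -
  have "w \<oplus> (v \<ominus> w) = v"
    using assms by (simp add: a_minus_def a_lcomm r_neg)
  then show ?thesis
    using assms ip_norm_triangle[of w "v \<ominus> w"] by (simp add: ip_dist_def)
qed

text \<open>The quantitative continuity of the form.  It yields both that the form is well defined on
  classes modulo null vectors and that it has limits along Cauchy sequences.\<close>
lemma ip_diff_bound: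
  assumes "v \<in> carrier H" "w \<in> carrier H" "v' \<in> carrier H" "w' \<in> carrier H"
  shows "cmod (ip H v w - ip H v' w')
    \<le> ip_dist H v v' * ip_norm H w + ip_norm H v' * ip_dist H w w'"
proof -
  have "ip H v w - ip H v' w' = ip H (v \<ominus> v') w + ip H v' (w \<ominus> w')"
    using assms by (simp add: ip_diff ip_diff_right)
  then show ?thesis
    using assms Cauchy_Schwarz[of "v \<ominus> v'" w] Cauchy_Schwarz[of v' "w \<ominus> w'"]
      norm_triangle_ineq[of "ip H (v \<ominus> v') w" "ip H v' (w \<ominus> w')"]
    by (simp add: ip_dist_def)
qed

end

section \<open>Separation of semi-inner product spaces\<close>

context semi_ip_space
begin

lemma null_space_eq: "null_space H = {v \<in> carrier H. ip_norm H v = 0}"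
  by (auto simp: null_space_def ip_self)

lemma abelian_subgroup_null_space: "abelian_subgroup (null_space H) H"
proof (rule abelian_subgroupI3)
  show "additive_subgroup (null_space H) H"
  proof (rule additive_subgroupI, unfold_locales)
    fix v w assume "v \<in> null_space H" "w \<in> null_space H"
    then show "v \<otimes>\<^bsub>add_monoid H\<^esub> w \<in> null_space H"
      using ip_norm_triangle[of v w] by (auto simp: null_space_eq intro: antisym)
  next
    fix v assume "v \<in> null_space H"
    then show "inv\<^bsub>add_monoid H\<^esub> v \<in> null_space H"
      using ip_norm_smult[of v "- 1"] smult_minus_one[of v]
      by (simp add: null_space_eq flip: a_inv_def)
  qed (auto simp: null_space_eq)
qed (rule abelian_group_axioms)

lemma subgroup_null_space: "subgroup (null_space H) (add_monoid H)"
  using abelian_subgroup_null_space by (simp add: abelian_subgroup_def additive_subgroup_def)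

lemma null_space_subset: "null_space H \<subseteq> carrier H"
  by (auto simp: null_space_def)

text \<open>Describing classes by distance \<open>0\<close> reduces questions about representatives to estimates of
  norms.\<close>
lemma mem_sep_class_iff:
  assumes "v \<in> carrier H"
  shows "w \<in> sep_class H v \<longleftrightarrow> w \<in> carrier H \<and> ip_dist H w v = 0"
proof (cases "w \<in> carrier H")
  case True
  have "w \<in> sep_class H v \<longleftrightarrow> w \<ominus> v \<in> null_space H"
    unfolding sep_class_def a_minus_def
    by (rule abelian_subgroup.a_rcos_module[OF abelian_subgroup_null_space assms True])
  also have "\<dots> \<longleftrightarrow> ip_dist H w v = 0"
    using assms True by (simp add: null_space_eq ip_dist_def)
  finally show ?thesis
    using True by simp
next
  case False
  moreover have "sep_class H v \<subseteq> carrier H"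
    unfolding sep_class_def by (rule a_r_coset_subset_G[OF null_space_subset assms])
  ultimately show ?thesis
    by blast
qed

lemma sep_class_eq_iff:
  assumes "v \<in> carrier H" "w \<in> carrier H"
  shows "sep_class H v = sep_class H w \<longleftrightarrow> ip_dist H v w = 0"
proof
  assume "sep_class H v = sep_class H w"
  then show "ip_dist H v w = 0"
    using assms mem_sep_class_iff[of v v] mem_sep_class_iff[of w v] by auto
next
  assume "ip_dist H v w = 0"
  then have "v \<in> null_space H +> w"
    using assms mem_sep_class_iff[of w v] by (simp add: sep_class_def)
  then show "sep_class H v = sep_class H w"
    using assms a_repr_independence[OF _ _ subgroup_null_space] by (simp add: sep_class_def)
qed

lemma some_in_sep_class:
  assumes "v \<in> carrier H"
  shows "(SOME w. w \<in> sep_class H v) \<in> carrier H"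
    and "ip_dist H (SOME w. w \<in> sep_class H v) v = 0"
  using someI[of "\<lambda>w. w \<in> sep_class H v" v] assms by (auto simp: mem_sep_class_iff)

lemma carrier_sep_quotient: "carrier (sep_quotient H) = sep_class H ` carrier H"
  by (auto simp: sep_quotient_def A_RCOSETS_def RCOSETS_def sep_class_def a_r_coset_def)

lemma sep_class_in_carrier [simp]: "v \<in> carrier H \<Longrightarrow> sep_class H v \<in> carrier (sep_quotient H)"
  by (simp add: carrier_sep_quotient)

lemma sep_class_zero: "\<zero>\<^bsub>sep_quotient H\<^esub> = sep_class H \<zero>"
  using null_space_subset by (simp add: sep_class_def sep_quotient_def)

lemma sep_class_add: "\<lbrakk>v \<in> carrier H; w \<in> carrier H\<rbrakk>
    \<Longrightarrow> sep_class H v \<oplus>\<^bsub>sep_quotient H\<^esub> sep_class H w = sep_class H (v \<oplus> w)"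
  by (simp add: sep_class_def sep_quotient_def
      abelian_subgroup.a_rcos_sum[OF abelian_subgroup_null_space])

lemma ip_sep_class:
  assumes "v \<in> carrier H" "w \<in> carrier H"
  shows "ip (sep_quotient H) (sep_class H v) (sep_class H w) = ip H v w"
proof -
  define v' w' where "v' = (SOME x. x \<in> sep_class H v)" and "w' = (SOME x. x \<in> sep_class H w)"
  have "cmod (ip H v' w' - ip H v w) \<le> ip_dist H v' v * ip_norm H w' + ip_norm H v * ip_dist H w' w"
    using assms some_in_sep_class[of v] some_in_sep_class[of w] ip_diff_bound[of v' w' v w]
    by (simp add: v'_def w'_def)
  also have "\<dots> = 0"
    using assms some_in_sep_class[of v] some_in_sep_class[of w] by (simp add: v'_def w'_def)
  finally show ?thesis
    by (simp add: sep_quotient_def v'_def w'_def)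
qed

lemma ip_norm_sep_class:
  "v \<in> carrier H \<Longrightarrow> ip_norm (sep_quotient H) (sep_class H v) = ip_norm H v"
  by (simp add: ip_norm_def ip_sep_class)

end

text \<open>Operators on quotients and completions are computed on arbitrary representatives.  A Lipschitz
  condition is what makes the result independent of that choice; it covers scalar multiplications
  and isometries alike and passes to the separation and to Cauchy sequences.  The constant is
  positive so that one may divide by it.\<close>
definition ip_lipschitz :: "('v, 'm) ip_space_scheme \<Rightarrow> ('v \<Rightarrow> 'v) \<Rightarrow> bool" where
  "ip_lipschitz H T \<longleftrightarrow> T ` carrier H \<subseteq> carrier H \<and>
     (\<exists>L>0. \<forall>v\<in>carrier H. \<forall>w\<in>carrier H. ip_dist H (T v) (T w) \<le> L * ip_dist H v w)"

context semi_ip_space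
begin

text \<open>The chosen representative has distance \<open>0\<close> from \<open>v\<close>, hence so have the images under \<open>T\<close>.\<close>
lemma sep_map_class:
  assumes "ip_lipschitz H T" "v \<in> carrier H"
  shows "sep_map H T (sep_class H v) = sep_class H (T v)"
proof -
  define w where "w = (SOME x. x \<in> sep_class H v)"
  have w: "w \<in> carrier H" "ip_dist H w v = 0"
    using some_in_sep_class[OF assms(2)] by (simp_all add: w_def)
  obtain L where "ip_dist H (T w) (T v) \<le> L * ip_dist H w v"
    using assms w unfolding ip_lipschitz_def by blast
  moreover have T: "T w \<in> carrier H" "T v \<in> carrier H"
    using assms w by (auto simp: ip_lipschitz_def)
  ultimately have "ip_dist H (T w) (T v) = 0"
    using w by (intro antisym) simp_all
  then show ?thesis
    using T by (simp add: sep_map_def sep_class_eq_iff flip: w_def)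
qed

lemma ip_lipschitz_smult: "ip_lipschitz H (\<lambda>v. c \<odot> v)"
  by (auto simp: ip_lipschitz_def ip_dist_smult intro!: exI[of _ "cmod c + 1"] mult_right_mono
      add_nonneg_pos)

lemma sep_class_smult: "v \<in> carrier H
    \<Longrightarrow> c \<odot>\<^bsub>sep_quotient H\<^esub> sep_class H v = sep_class H (c \<odot> v)"
  using sep_map_class[OF ip_lipschitz_smult] by (simp add: sep_quotient_def)

lemma semi_ip_space_sep_quotient: "semi_ip_space (sep_quotient H)"
proof (intro semi_ip_space.intro semi_ip_space_axioms.intro)
  show "abelian_group (sep_quotient H)"
  proof (rule abelian_groupI)
    fix A assume "A \<in> carrier (sep_quotient H)"
    then obtain v where "v \<in> carrier H" "A = sep_class H v"
      by (auto simp: carrier_sep_quotient)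
    then show "\<exists>A'\<in>carrier (sep_quotient H).
        A' \<oplus>\<^bsub>sep_quotient H\<^esub> A = \<zero>\<^bsub>sep_quotient H\<^esub>"
      by (intro bexI[of _ "sep_class H (\<ominus> v)"]) (simp_all add: sep_class_add sep_class_zero l_neg)
  qed (auto simp: carrier_sep_quotient sep_class_add sep_class_zero a_ac)
qed (auto simp: carrier_sep_quotient sep_class_add sep_class_smult ip_sep_class
    smult_r_distr smult_l_distr smult_assoc ip_add ip_smult ip_ge_0 ip_commute[symmetric])

lemma ip_dist_sep_class:
  assumes "v \<in> carrier H" "w \<in> carrier H"
  shows "ip_dist (sep_quotient H) (sep_class H v) (sep_class H w) = ip_dist H v w"
proof -
  interpret Q: semi_ip_space "sep_quotient H"
    by (rule semi_ip_space_sep_quotient)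
  have "sep_class H v \<ominus>\<^bsub>sep_quotient H\<^esub> sep_class H w = sep_class H (v \<ominus> w)"
    using assms
    by (simp add: a_minus_def sep_class_add sep_class_smult smult_minus_one flip: Q.smult_minus_one)
  then show ?thesis
    using assms by (simp add: ip_dist_def ip_norm_sep_class)
qed

lemma ip_lipschitz_sep_map:
  assumes "ip_lipschitz H T"
  shows "ip_lipschitz (sep_quotient H) (sep_map H T)"
proof -
  have T: "T v \<in> carrier H" if "v \<in> carrier H" for v
    using assms that by (auto simp: ip_lipschitz_def)
  obtain L where "L > 0" "ip_dist H (T v) (T w) \<le> L * ip_dist H v w"
    if "v \<in> carrier H" "w \<in> carrier H" for v w
    using assms unfolding ip_lipschitz_def by blast
  then show ?thesis
    using assms T by (force simp: ip_lipschitz_def[of "sep_quotient H"] carrier_sep_quotient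
        sep_map_class ip_dist_sep_class intro: exI[of _ L])
qed

end

section \<open>Completion of semi-inner product spaces\<close>

context semi_ip_space
begin

lemma cauchy_space_simps [simp]:
  "\<zero>\<^bsub>cauchy_space H\<^esub> = (\<lambda>k. \<zero>)"
  "x \<oplus>\<^bsub>cauchy_space H\<^esub> y = (\<lambda>k. x k \<oplus> y k)"
  "c \<odot>\<^bsub>cauchy_space H\<^esub> x = (\<lambda>k. c \<odot> x k)"
  by (simp_all add: cauchy_space_def)

lemma cauchy_spaceI:
  assumes "\<And>k. x k \<in> carrier H"
    and "\<And>e. e > 0 \<Longrightarrow> \<exists>M. \<forall>m\<ge>M. \<forall>n\<ge>M. ip_dist H (x m) (x n) < e"
  shows "x \<in> carrier (cauchy_space H)"
  using assms by (simp add: cauchy_space_def)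

lemma cauchy_spaceD:
  assumes "x \<in> carrier (cauchy_space H)"
  shows "x k \<in> carrier H"
    and "e > 0 \<Longrightarrow> \<exists>M. \<forall>m\<ge>M. \<forall>n\<ge>M. ip_dist H (x m) (x n) < e"
  using assms by (simp_all add: cauchy_space_def)

lemma const_in_cauchy_space: "v \<in> carrier H \<Longrightarrow> (\<lambda>k. v) \<in> carrier (cauchy_space H)"
  by (simp add: cauchy_space_def)

lemma lipschitz_image_in_cauchy_space:
  assumes "ip_lipschitz H T" "x \<in> carrier (cauchy_space H)"
  shows "(\<lambda>k. T (x k)) \<in> carrier (cauchy_space H)"
proof (rule cauchy_spaceI)
  show "T (x k) \<in> carrier H" for k
    using assms cauchy_spaceD(1)[OF assms(2)] unfolding ip_lipschitz_def by blast
next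
  fix e :: real assume "e > 0"
  obtain L where L: "L > 0"
    "\<And>v w. v \<in> carrier H \<Longrightarrow> w \<in> carrier H \<Longrightarrow> ip_dist H (T v) (T w) \<le> L * ip_dist H v w"
    using assms unfolding ip_lipschitz_def by blast
  then have "e / L > 0"
    using \<open>e > 0\<close> by simp
  then obtain M where M: "\<And>m n. m \<ge> M \<Longrightarrow> n \<ge> M \<Longrightarrow> ip_dist H (x m) (x n) < e / L"
    using cauchy_spaceD(2)[OF assms(2)] by blast
  have "ip_dist H (T (x m)) (T (x n)) < e" if "m \<ge> M" "n \<ge> M" for m n
  proof -
    have "ip_dist H (T (x m)) (T (x n)) \<le> L * ip_dist H (x m) (x n)"
      using L(2) cauchy_spaceD(1)[OF assms(2)] by blast
    also have "\<dots> < L * (e / L)"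
      using M[OF that] L(1) by (rule mult_strict_left_mono)
    finally show ?thesis
      using L(1) by simp
  qed
  then show "\<exists>M. \<forall>m\<ge>M. \<forall>n\<ge>M. ip_dist H (T (x m)) (T (x n)) < e"
    by blast
qed

lemma cauchy_space_add:
  assumes x: "x \<in> carrier (cauchy_space H)" and y: "y \<in> carrier (cauchy_space H)"
  shows "(\<lambda>k. x k \<oplus> y k) \<in> carrier (cauchy_space H)"
proof (rule cauchy_spaceI)
  show "x k \<oplus> y k \<in> carrier H" for k
    using cauchy_spaceD(1)[OF x] cauchy_spaceD(1)[OF y] by simp
next
  fix e :: real assume "e > 0"
  obtain M where M: "\<And>m n. m \<ge> M \<Longrightarrow> n \<ge> M \<Longrightarrow> ip_dist H (x m) (x n) < e / 2"
    using cauchy_spaceD(2)[OF x half_gt_zero[OF \<open>e > 0\<close>]] by blast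
  obtain M' where M': "\<And>m n. m \<ge> M' \<Longrightarrow> n \<ge> M' \<Longrightarrow> ip_dist H (y m) (y n) < e / 2"
    using cauchy_spaceD(2)[OF y half_gt_zero[OF \<open>e > 0\<close>]] by blast
  have "ip_dist H (x m \<oplus> y m) (x n \<oplus> y n) < e" if "m \<ge> max M M'" "n \<ge> max M M'" for m n
    using ip_dist_add[of "x m" "y m" "x n" "y n"] cauchy_spaceD(1)[OF x] cauchy_spaceD(1)[OF y]
      M[of m n] M'[of m n] that by fastforce
  then show "\<exists>M. \<forall>m\<ge>M. \<forall>n\<ge>M. ip_dist H (x m \<oplus> y m) (x n \<oplus> y n) < e"
    by blast
qed

lemma cauchy_space_norm_bounded:
  assumes x: "x \<in> carrier (cauchy_space H)"
  obtains B where "B > 0" "\<And>k. ip_norm H (x k) \<le> B"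
proof -
  have "Cauchy (\<lambda>k. ip_norm H (x k))"
  proof (rule CauchyI)
    fix e :: real assume "0 < e"
    then obtain M where M: "\<And>m n. m \<ge> M \<Longrightarrow> n \<ge> M \<Longrightarrow> ip_dist H (x m) (x n) < e"
      using cauchy_spaceD(2)[OF x] by blast
    have "norm (ip_norm H (x m) - ip_norm H (x n)) < e" if "m \<ge> M" "n \<ge> M" for m n
      using ip_norm_diff_le[of "x m" "x n"] ip_norm_diff_le[of "x n" "x m"]
        M[of m n] M[of n m] that cauchy_spaceD(1)[OF x] by (simp add: abs_less_iff)
    then show "\<exists>M. \<forall>m\<ge>M. \<forall>n\<ge>M. norm (ip_norm H (x m) - ip_norm H (x n)) < e"
      by blast
  qed
  then obtain B where "B > 0" "\<And>k. norm (ip_norm H (x k)) \<le> B"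
    using Cauchy_Bseq BseqE by metis
  then show ?thesis
    using that abs_le_D1 unfolding real_norm_def by blast
qed

text \<open>The form on Cauchy sequences is defined by \<^const>\<open>lim\<close>, which is arbitrary for divergent
  sequences.  The limit exists because Cauchy sequences are bounded in norm.\<close>
lemma tendsto_ip_cauchy_space:
  assumes x: "x \<in> carrier (cauchy_space H)" and y: "y \<in> carrier (cauchy_space H)"
  shows "(\<lambda>k. ip H (x k) (y k)) \<longlonglongrightarrow> ip (cauchy_space H) x y"
proof -
  obtain A where A: "A > 0" "\<And>k. ip_norm H (x k) \<le> A"
    using cauchy_space_norm_bounded[OF x] by blast
  obtain B where B: "B > 0" "\<And>k. ip_norm H (y k) \<le> B"
    using cauchy_space_norm_bounded[OF y] by blast
  have "Cauchy (\<lambda>k. ip H (x k) (y k))"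
  proof (rule CauchyI)
    fix e :: real assume "e > 0"
    define d where "d = e / (A + B)"
    have "d > 0"
      using \<open>e > 0\<close> A(1) B(1) by (simp add: d_def)
    obtain M where M: "\<And>m n. m \<ge> M \<Longrightarrow> n \<ge> M \<Longrightarrow> ip_dist H (x m) (x n) < d"
      using cauchy_spaceD(2)[OF x \<open>d > 0\<close>] by blast
    obtain M' where M': "\<And>m n. m \<ge> M' \<Longrightarrow> n \<ge> M' \<Longrightarrow> ip_dist H (y m) (y n) < d"
      using cauchy_spaceD(2)[OF y \<open>d > 0\<close>] by blast
    have "norm (ip H (x m) (y m) - ip H (x n) (y n)) < e"
      if "m \<ge> max M M'" "n \<ge> max M M'" for m n
    proof -
      have c: "x k \<in> carrier H" "y k \<in> carrier H" for k
        using cauchy_spaceD(1)[OF x] cauchy_spaceD(1)[OF y] by auto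
      have "norm (ip H (x m) (y m) - ip H (x n) (y n))
          \<le> ip_dist H (x m) (x n) * ip_norm H (y m) + ip_norm H (x n) * ip_dist H (y m) (y n)"
        using c by (rule ip_diff_bound) (rule c)+
      also have "\<dots> \<le> ip_dist H (x m) (x n) * B + A * ip_dist H (y m) (y n)"
        using c A B by (intro add_mono mult_left_mono mult_right_mono) auto
      also have "\<dots> < d * B + A * d"
        using M[of m n] M'[of m n] that A(1) B(1) by (intro add_strict_mono) auto
      also have "\<dots> = d * (A + B)"
        by (simp add: algebra_simps)
      also have "\<dots> = e"
        using A(1) B(1) by (simp add: d_def)
      finally show ?thesis .
    qed
    then show "\<exists>M. \<forall>m\<ge>M. \<forall>n\<ge>M. norm (ip H (x m) (y m) - ip H (x n) (y n)) < e"
      by blast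
  qed
  then show ?thesis
    by (simp add: cauchy_space_def Cauchy_convergent convergent_LIMSEQ_iff[symmetric])
qed

lemma ip_cauchy_space_eqI:
  assumes "x \<in> carrier (cauchy_space H)" "y \<in> carrier (cauchy_space H)"
    and "(\<lambda>k. ip H (x k) (y k)) \<longlonglongrightarrow> l"
  shows "ip (cauchy_space H) x y = l"
  using LIMSEQ_unique tendsto_ip_cauchy_space assms by blast

lemma semi_ip_space_cauchy_space: "semi_ip_space (cauchy_space H)"
proof -
  have smult: "(\<lambda>k. c \<odot> x k) \<in> carrier (cauchy_space H)" if "x \<in> carrier (cauchy_space H)" for c x
    using lipschitz_image_in_cauchy_space[OF ip_lipschitz_smult that] .
  have "abelian_group (cauchy_space H)"
  proof (rule abelian_groupI)
    fix x assume x: "x \<in> carrier (cauchy_space H)"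
    have "(\<lambda>k. \<ominus> x k) \<in> carrier (cauchy_space H)"
      using smult[OF x, of "- 1"] cauchy_spaceD(1)[OF x] by (simp add: smult_minus_one)
    then show "\<exists>y\<in>carrier (cauchy_space H). y \<oplus>\<^bsub>cauchy_space H\<^esub> x = \<zero>\<^bsub>cauchy_space H\<^esub>"
      using cauchy_spaceD(1)[OF x] by (intro bexI) (simp_all add: l_neg)
  qed (simp_all add: cauchy_space_add const_in_cauchy_space cauchy_spaceD(1) a_ac)
  moreover have "semi_ip_space_axioms (cauchy_space H)"
  proof
    fix x y z assume x: "x \<in> carrier (cauchy_space H)" and y: "y \<in> carrier (cauchy_space H)"
      and z: "z \<in> carrier (cauchy_space H)"
    have "(\<lambda>k. ip H (x k \<oplus> y k) (z k)) \<longlonglongrightarrow>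
        ip (cauchy_space H) x z + ip (cauchy_space H) y z"
      using tendsto_add[OF tendsto_ip_cauchy_space[OF x z] tendsto_ip_cauchy_space[OF y z]]
        cauchy_spaceD(1)[OF x] cauchy_spaceD(1)[OF y] cauchy_spaceD(1)[OF z] by (simp add: ip_add)
    then show "ip (cauchy_space H) (x \<oplus>\<^bsub>cauchy_space H\<^esub> y) z =
        ip (cauchy_space H) x z + ip (cauchy_space H) y z"
      using cauchy_space_add x y z by (simp add: ip_cauchy_space_eqI)
  next
    fix x y and c :: complex
    assume x: "x \<in> carrier (cauchy_space H)" and y: "y \<in> carrier (cauchy_space H)"
    have "(\<lambda>k. ip H (c \<odot> x k) (y k)) \<longlonglongrightarrow> c * ip (cauchy_space H) x y"
      using tendsto_mult[OF tendsto_const[of c] tendsto_ip_cauchy_space[OF x y]]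
        cauchy_spaceD(1)[OF x] cauchy_spaceD(1)[OF y] by (simp add: ip_smult)
    then show "ip (cauchy_space H) (c \<odot>\<^bsub>cauchy_space H\<^esub> x) y = c * ip (cauchy_space H) x y"
      using smult x y by (simp add: ip_cauchy_space_eqI)
    have "(\<lambda>k. ip H (y k) (x k)) \<longlonglongrightarrow> cnj (ip (cauchy_space H) x y)"
      using tendsto_cnj[OF tendsto_ip_cauchy_space[OF x y]]
        cauchy_spaceD(1)[OF x] cauchy_spaceD(1)[OF y] by (simp flip: ip_commute)
    then show "ip (cauchy_space H) y x = cnj (ip (cauchy_space H) x y)"
      using x y by (simp add: ip_cauchy_space_eqI)
  next
    fix x assume x: "x \<in> carrier (cauchy_space H)"
    show "0 \<le> Re (ip (cauchy_space H) x x)"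
      using LIMSEQ_le_const[OF tendsto_Re[OF tendsto_ip_cauchy_space[OF x x]]]
        ip_ge_0 cauchy_spaceD(1)[OF x] by blast
  qed (simp_all add: smult cauchy_spaceD(1) smult_l_distr smult_r_distr smult_assoc)
  ultimately show ?thesis
    by (rule semi_ip_space.intro)
qed

lemma tendsto_ip_dist_cauchy_space:
  assumes x: "x \<in> carrier (cauchy_space H)" and y: "y \<in> carrier (cauchy_space H)"
  shows "(\<lambda>k. ip_dist H (x k) (y k)) \<longlonglongrightarrow> ip_dist (cauchy_space H) x y"
proof -
  interpret C: semi_ip_space "cauchy_space H"
    by (rule semi_ip_space_cauchy_space)
  have "\<ominus>\<^bsub>cauchy_space H\<^esub> y = (\<lambda>k. \<ominus> y k)"
    using C.smult_minus_one[OF y] cauchy_spaceD(1)[OF y] by (simp add: smult_minus_one)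
  then have "x \<ominus>\<^bsub>cauchy_space H\<^esub> y = (\<lambda>k. x k \<ominus> y k)"
    by (simp add: a_minus_def)
  then show ?thesis
    using tendsto_ip_cauchy_space[OF C.minus_closed[OF x y] C.minus_closed[OF x y]]
    by (auto simp: ip_dist_def ip_norm_def intro!: tendsto_intros)
qed

lemma ip_lipschitz_cauchy_space:
  assumes "ip_lipschitz H T"
  shows "ip_lipschitz (cauchy_space H) (\<lambda>x k. T (x k))"
proof -
  obtain L where L: "L > 0"
    "\<And>v w. v \<in> carrier H \<Longrightarrow> w \<in> carrier H \<Longrightarrow> ip_dist H (T v) (T w) \<le> L * ip_dist H v w"
    using assms unfolding ip_lipschitz_def by blast
  have "ip_dist (cauchy_space H) (\<lambda>k. T (x k)) (\<lambda>k. T (y k)) \<le> L * ip_dist (cauchy_space H) x y"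
    if x: "x \<in> carrier (cauchy_space H)" and y: "y \<in> carrier (cauchy_space H)" for x y
    using lipschitz_image_in_cauchy_space[OF assms] x y
    by (intro LIMSEQ_le[OF tendsto_ip_dist_cauchy_space
          tendsto_mult[OF tendsto_const tendsto_ip_dist_cauchy_space]])
      (auto intro!: L(2) cauchy_spaceD(1))
  then show ?thesis
    using L(1) lipschitz_image_in_cauchy_space[OF assms]
    unfolding ip_lipschitz_def by blast
qed

interpretation C: semi_ip_space "cauchy_space H"
  by (rule semi_ip_space_cauchy_space)

lemma semi_ip_space_completion: "semi_ip_space (completion H)"
  unfolding completion_def by (rule C.semi_ip_space_sep_quotient)

lemma completion_emb_in_carrier [simp]:
  "v \<in> carrier H \<Longrightarrow> completion_emb H v \<in> carrier (completion H)"
  by (simp add: completion_def completion_emb_def const_in_cauchy_space)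

lemma completion_emb_smult:
  "v \<in> carrier H \<Longrightarrow> c \<odot>\<^bsub>completion H\<^esub> completion_emb H v = completion_emb H (c \<odot> v)"
  by (simp add: completion_def completion_emb_def C.sep_class_smult const_in_cauchy_space)

lemma ip_norm_completion_emb:
  assumes "v \<in> carrier H"
  shows "ip_norm (completion H) (completion_emb H v) = ip_norm H v"
proof -
  have "ip (cauchy_space H) (\<lambda>k. v) (\<lambda>k. v) = ip H v v"
    using assms by (simp add: ip_cauchy_space_eqI const_in_cauchy_space)
  then have "ip_norm (cauchy_space H) (\<lambda>k. v) = ip_norm H v"
    by (simp add: ip_norm_def)
  then show ?thesis
    using assms
    by (simp add: completion_def completion_emb_def C.ip_norm_sep_class const_in_cauchy_space)
qed

lemma completion_map_emb:
  "\<lbrakk>ip_lipschitz H T; v \<in> carrier H\<rbrakk>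
    \<Longrightarrow> completion_map H T (completion_emb H v) = completion_emb H (T v)"
  by (simp add: completion_map_def completion_emb_def C.sep_map_class ip_lipschitz_cauchy_space
      const_in_cauchy_space)

end

section \<open>Ultraproducts of semi-inner product spaces\<close>

text \<open>Were no point of a compact interval a limit, each would have a neighbourhood that the function
  avoids eventually; finitely many of these cover the interval, so that the function would
  eventually avoid all its possible values.\<close>
lemma ultrafilter_tendsto_real:
  fixes f :: "'a \<Rightarrow> real"
  assumes "U \<noteq> bot" "\<And>P. eventually P U \<or> eventually (\<lambda>n. \<not> P n) U"
    and "\<And>n. \<bar>f n\<bar> \<le> B"
  shows "\<exists>l. (f \<longlongrightarrow> l) U"
proof -
  have "\<exists>S. open S \<and> l \<in> S \<and> eventually (\<lambda>n. f n \<notin> S) U" if "\<not> (f \<longlongrightarrow> l) U" for l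
    using that assms(2) unfolding tendsto_def by blast
  then obtain S where S: "\<forall>l. \<not> (f \<longlongrightarrow> l) U \<longrightarrow>
      open (S l) \<and> l \<in> S l \<and> eventually (\<lambda>n. f n \<notin> S l) U"
    by metis
  show ?thesis
  proof (rule ccontr)
    assume "\<nexists>l. (f \<longlongrightarrow> l) U"
    with S have S: "open (S l)" "l \<in> S l" "eventually (\<lambda>n. f n \<notin> S l) U" for l
      by simp_all
    have cover: "{- B..B} \<subseteq> (\<Union>l\<in>UNIV. S l)"
      using S(2) by blast
    obtain C where "C \<subseteq> UNIV" and C: "finite C" "{- B..B} \<subseteq> (\<Union>l\<in>C. S l)"
      by (rule compactE_image[OF compact_Icc _ cover]) (rule S(1))
    have "eventually (\<lambda>n. \<forall>l\<in>C. f n \<notin> S l) U"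
      using C(1) S(3) by (intro eventually_ball_finite) auto
    moreover have "f n \<in> (\<Union>l\<in>C. S l)" for n
    proof -
      have "f n \<in> {- B..B}"
        using assms(3)[of n] by (simp add: abs_le_iff minus_le_iff)
      then show ?thesis
        using C(2) by blast
    qed
    ultimately have "eventually (\<lambda>n. False) U"
      by (elim eventually_mono) blast
    then show False
      using assms(1) by simp
  qed
qed

lemma ultrafilter_tendsto_complex:
  fixes f :: "'a \<Rightarrow> complex"
  assumes "U \<noteq> bot" "\<And>P. eventually P U \<or> eventually (\<lambda>n. \<not> P n) U"
    and "\<And>n. cmod (f n) \<le> B"
  shows "\<exists>l. (f \<longlongrightarrow> l) U"
proof -
  have "\<bar>Re (f n)\<bar> \<le> B" "\<bar>Im (f n)\<bar> \<le> B" for n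
    using abs_Re_le_cmod[of "f n"] abs_Im_le_cmod[of "f n"] assms(3)[of n] by linarith+
  then obtain a b where "((\<lambda>n. Re (f n)) \<longlongrightarrow> a) U" "((\<lambda>n. Im (f n)) \<longlongrightarrow> b) U"
    using ultrafilter_tendsto_real[OF assms(1,2), of "\<lambda>n. Re (f n)" B]
      ultrafilter_tendsto_real[OF assms(1,2), of "\<lambda>n. Im (f n)" B] by blast
  then have "((\<lambda>n. Complex (Re (f n)) (Im (f n))) \<longlongrightarrow> Complex a b) U"
    by (rule tendsto_Complex)
  then show ?thesis
    by auto
qed

text \<open>Ordinary limits of sequences are therefore limits along \<open>U\<close>.\<close>
lemma nonprincipal_ultrafilter_le_sequentially:
  assumes "nonprincipal_ultrafilter U"
  shows "U \<le> sequentially"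
proof (rule filter_leI)
  fix P :: "nat \<Rightarrow> bool" assume "eventually P sequentially"
  then obtain M where M: "\<And>n. n \<ge> M \<Longrightarrow> P n"
    by (auto simp: eventually_sequentially)
  have "eventually (\<lambda>n. \<forall>m\<in>{..<M}. n \<noteq> m) U"
    using assms by (intro eventually_ball_finite) (auto simp: nonprincipal_ultrafilter_def)
  then show "eventually P U"
    by (rule eventually_mono) (use M linorder_not_le in auto)
qed

locale semi_ip_ultraproduct =
  fixes U :: "nat filter" and K :: "nat \<Rightarrow> 'v ip_space"
  assumes ultrafilter: "nonprincipal_ultrafilter U"
    and semi_ip_space: "\<And>n. semi_ip_space (K n)"
begin

sublocale K: semi_ip_space "K n" for n
  by (rule semi_ip_space)

abbreviation "bdd_seqs \<equiv> bounded_sequences U K"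

lemma bounded_sequences_simps [simp]:
  "\<zero>\<^bsub>bdd_seqs\<^esub> = (\<lambda>n. \<zero>\<^bsub>K n\<^esub>)"
  "\<xi> \<oplus>\<^bsub>bdd_seqs\<^esub> \<eta> = (\<lambda>n. \<xi> n \<oplus>\<^bsub>K n\<^esub> \<eta> n)"
  "c \<odot>\<^bsub>bdd_seqs\<^esub> \<xi> = (\<lambda>n. c \<odot>\<^bsub>K n\<^esub> \<xi> n)"
  by (simp_all add: bounded_sequences_def)

lemma bounded_sequencesI:
  "\<lbrakk>\<And>n. \<xi> n \<in> carrier (K n); \<And>n. ip_norm (K n) (\<xi> n) \<le> b\<rbrakk> \<Longrightarrow> \<xi> \<in> carrier bdd_seqs"
  by (auto simp: bounded_sequences_def bdd_above_def)

lemma bounded_sequencesD: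
  assumes "\<xi> \<in> carrier bdd_seqs"
  shows "\<xi> n \<in> carrier (K n)" and "\<exists>b. \<forall>n. ip_norm (K n) (\<xi> n) \<le> b"
  using assms by (auto simp: bounded_sequences_def bdd_above_def)

lemma U_not_bot [simp]: "U \<noteq> bot"
  using ultrafilter by (simp add: nonprincipal_ultrafilter_def)

lemma tendsto_ip_bounded_sequences:
  assumes "\<xi> \<in> carrier bdd_seqs" "\<eta> \<in> carrier bdd_seqs"
  shows "((\<lambda>n. ip (K n) (\<xi> n) (\<eta> n)) \<longlongrightarrow> ip bdd_seqs \<xi> \<eta>) U"
proof -
  obtain a where a: "\<And>n. ip_norm (K n) (\<xi> n) \<le> a"
    using bounded_sequencesD(2)[OF assms(1)] by blast
  obtain b where b: "\<And>n. ip_norm (K n) (\<eta> n) \<le> b"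
    using bounded_sequencesD(2)[OF assms(2)] by blast
  have "cmod (ip (K n) (\<xi> n) (\<eta> n)) \<le> a * b" for n
  proof -
    have c: "\<xi> n \<in> carrier (K n)" "\<eta> n \<in> carrier (K n)"
      using assms by (auto intro: bounded_sequencesD)
    have "cmod (ip (K n) (\<xi> n) (\<eta> n)) \<le> ip_norm (K n) (\<xi> n) * ip_norm (K n) (\<eta> n)"
      using c by (rule K.Cauchy_Schwarz)
    also have "\<dots> \<le> a * b"
      using a[of n] b[of n] K.ip_norm_ge_0[OF c(1)] K.ip_norm_ge_0[OF c(2)]
      by (intro mult_mono) linarith+
    finally show ?thesis .
  qed
  then obtain l where "((\<lambda>n. ip (K n) (\<xi> n) (\<eta> n)) \<longlongrightarrow> l) U"
    using ultrafilter_tendsto_complex[OF U_not_bot] ultrafilter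
    unfolding nonprincipal_ultrafilter_def by meson
  moreover from this have "Lim U (\<lambda>n. ip (K n) (\<xi> n) (\<eta> n)) = l"
    by (rule tendsto_Lim[OF U_not_bot])
  ultimately show ?thesis
    by (simp add: bounded_sequences_def)
qed

lemma ip_bounded_sequences_eqI:
  assumes "\<xi> \<in> carrier bdd_seqs" "\<eta> \<in> carrier bdd_seqs" "((\<lambda>n. ip (K n) (\<xi> n) (\<eta> n)) \<longlongrightarrow> l) U"
  shows "ip bdd_seqs \<xi> \<eta> = l"
  using tendsto_unique[OF U_not_bot] tendsto_ip_bounded_sequences assms by blast

lemma bounded_sequences_add:
  assumes "\<xi> \<in> carrier bdd_seqs" "\<eta> \<in> carrier bdd_seqs"
  shows "(\<lambda>n. \<xi> n \<oplus>\<^bsub>K n\<^esub> \<eta> n) \<in> carrier bdd_seqs"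
proof -
  obtain a where a: "\<And>n. ip_norm (K n) (\<xi> n) \<le> a"
    using bounded_sequencesD(2)[OF assms(1)] by blast
  obtain b where b: "\<And>n. ip_norm (K n) (\<eta> n) \<le> b"
    using bounded_sequencesD(2)[OF assms(2)] by blast
  show ?thesis
  proof (rule bounded_sequencesI)
    show "ip_norm (K n) (\<xi> n \<oplus>\<^bsub>K n\<^esub> \<eta> n) \<le> a + b" for n
      using K.ip_norm_triangle[OF bounded_sequencesD(1)[OF assms(1)] bounded_sequencesD(1)[OF assms(2)]]
        a[of n] b[of n] by (meson add_mono order_trans)
  qed (use assms in \<open>simp add: bounded_sequencesD\<close>)
qed

lemma bounded_sequences_smult:
  assumes "\<xi> \<in> carrier bdd_seqs"
  shows "(\<lambda>n. c \<odot>\<^bsub>K n\<^esub> \<xi> n) \<in> carrier bdd_seqs"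
proof -
  obtain a where a: "\<And>n. ip_norm (K n) (\<xi> n) \<le> a"
    using bounded_sequencesD(2)[OF assms(1)] by blast
  show ?thesis
    by (rule bounded_sequencesI[of _ "cmod c * a"])
      (use a in \<open>simp_all add: bounded_sequencesD(1)[OF assms] K.ip_norm_smult mult_left_mono\<close>)
qed

lemma semi_ip_space_bounded_sequences: "semi_ip_space bdd_seqs"
proof (rule semi_ip_space.intro)
  show "abelian_group bdd_seqs"
  proof (rule abelian_groupI)
    fix \<xi> assume \<xi>: "\<xi> \<in> carrier bdd_seqs"
    have "(\<lambda>n. \<ominus>\<^bsub>K n\<^esub> \<xi> n) \<in> carrier bdd_seqs"
      using bounded_sequences_smult[OF \<xi>, of "- 1"] bounded_sequencesD(1)[OF \<xi>]
      by (simp add: K.smult_minus_one)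
    then show "\<exists>\<eta>\<in>carrier bdd_seqs. \<eta> \<oplus>\<^bsub>bdd_seqs\<^esub> \<xi> = \<zero>\<^bsub>bdd_seqs\<^esub>"
      using bounded_sequencesD(1)[OF \<xi>] by (intro bexI) (simp_all add: K.l_neg)
  next
    show "\<zero>\<^bsub>bdd_seqs\<^esub> \<in> carrier bdd_seqs"
      by (auto intro: bounded_sequencesI[of _ 0])
  qed (simp_all add: bounded_sequences_add bounded_sequencesD(1) K.a_ac)
next
  show "semi_ip_space_axioms bdd_seqs"
  proof
    fix \<xi> \<eta> \<zeta> assume \<xi>: "\<xi> \<in> carrier bdd_seqs" and \<eta>: "\<eta> \<in> carrier bdd_seqs" and \<zeta>: "\<zeta> \<in> carrier bdd_seqs"
    have "((\<lambda>n. ip (K n) (\<xi> n \<oplus>\<^bsub>K n\<^esub> \<eta> n) (\<zeta> n)) \<longlongrightarrow> ip bdd_seqs \<xi> \<zeta> + ip bdd_seqs \<eta> \<zeta>) U"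
      using tendsto_add[OF tendsto_ip_bounded_sequences[OF \<xi> \<zeta>]
          tendsto_ip_bounded_sequences[OF \<eta> \<zeta>]]
        bounded_sequencesD(1)[OF \<xi>] bounded_sequencesD(1)[OF \<eta>] bounded_sequencesD(1)[OF \<zeta>]
      by (simp add: K.ip_add)
    then show "ip bdd_seqs (\<xi> \<oplus>\<^bsub>bdd_seqs\<^esub> \<eta>) \<zeta> = ip bdd_seqs \<xi> \<zeta> + ip bdd_seqs \<eta> \<zeta>"
      using bounded_sequences_add \<xi> \<eta> \<zeta> by (simp add: ip_bounded_sequences_eqI)
  next
    fix \<xi> \<eta> and c :: complex
    assume \<xi>: "\<xi> \<in> carrier bdd_seqs" and \<eta>: "\<eta> \<in> carrier bdd_seqs"
    have "((\<lambda>n. ip (K n) (c \<odot>\<^bsub>K n\<^esub> \<xi> n) (\<eta> n)) \<longlongrightarrow> c * ip bdd_seqs \<xi> \<eta>) U"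
      using tendsto_mult[OF tendsto_const[of c] tendsto_ip_bounded_sequences[OF \<xi> \<eta>]]
        bounded_sequencesD(1)[OF \<xi>] bounded_sequencesD(1)[OF \<eta>] by (simp add: K.ip_smult)
    then show "ip bdd_seqs (c \<odot>\<^bsub>bdd_seqs\<^esub> \<xi>) \<eta> = c * ip bdd_seqs \<xi> \<eta>"
      using bounded_sequences_smult \<xi> \<eta> by (simp add: ip_bounded_sequences_eqI)
    have "((\<lambda>n. ip (K n) (\<eta> n) (\<xi> n)) \<longlongrightarrow> cnj (ip bdd_seqs \<xi> \<eta>)) U"
      using tendsto_cnj[OF tendsto_ip_bounded_sequences[OF \<xi> \<eta>]]
        bounded_sequencesD(1)[OF \<xi>] bounded_sequencesD(1)[OF \<eta>] by (simp flip: K.ip_commute)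
    then show "ip bdd_seqs \<eta> \<xi> = cnj (ip bdd_seqs \<xi> \<eta>)"
      using \<xi> \<eta> by (simp add: ip_bounded_sequences_eqI)
  next
    fix \<xi> assume \<xi>: "\<xi> \<in> carrier bdd_seqs"
    show "0 \<le> Re (ip bdd_seqs \<xi> \<xi>)"
      by (rule tendsto_lowerbound[OF tendsto_Re[OF tendsto_ip_bounded_sequences[OF \<xi> \<xi>]]])
        (simp_all add: K.ip_ge_0 bounded_sequencesD(1)[OF \<xi>])
  qed (simp_all add: bounded_sequences_smult bounded_sequencesD(1) K.smult_l_distr K.smult_r_distr
      K.smult_assoc)
qed

lemma tendsto_ip_norm_bounded_sequences:
  assumes "\<xi> \<in> carrier bdd_seqs"
  shows "((\<lambda>n. ip_norm (K n) (\<xi> n)) \<longlongrightarrow> ip_norm bdd_seqs \<xi>) U"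
  unfolding ip_norm_def
  by (intro tendsto_intros tendsto_ip_bounded_sequences assms)

lemma tendsto_ip_dist_bounded_sequences:
  assumes \<xi>: "\<xi> \<in> carrier bdd_seqs" and \<eta>: "\<eta> \<in> carrier bdd_seqs"
  shows "((\<lambda>n. ip_dist (K n) (\<xi> n) (\<eta> n)) \<longlongrightarrow> ip_dist bdd_seqs \<xi> \<eta>) U"
proof -
  interpret bdd_seqs: semi_ip_space bdd_seqs
    by (rule semi_ip_space_bounded_sequences)
  have "\<ominus>\<^bsub>bdd_seqs\<^esub> \<eta> = (\<lambda>n. \<ominus>\<^bsub>K n\<^esub> \<eta> n)"
    using bdd_seqs.smult_minus_one[OF \<eta>] bounded_sequencesD(1)[OF \<eta>] by (simp add: K.smult_minus_one)
  then have "\<xi> \<ominus>\<^bsub>bdd_seqs\<^esub> \<eta> = (\<lambda>n. \<xi> n \<ominus>\<^bsub>K n\<^esub> \<eta> n)"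
    by (simp add: a_minus_def)
  then show ?thesis
    using tendsto_ip_norm_bounded_sequences[OF bdd_seqs.minus_closed[OF \<xi> \<eta>]] by (simp add: ip_dist_def)
qed

text \<open>The two metric hypotheses say that each \<open>T n\<close> is a norm-preserving isometry; preservation
  of norms keeps bounded sequences bounded.\<close>
lemma ip_lipschitz_bounded_sequences:
  assumes "\<And>n v. v \<in> carrier (K n) \<Longrightarrow> T n v \<in> carrier (K n)"
    and norm: "\<And>n v. v \<in> carrier (K n) \<Longrightarrow> ip_norm (K n) (T n v) = ip_norm (K n) v"
    and dist: "\<And>n v w. \<lbrakk>v \<in> carrier (K n); w \<in> carrier (K n)\<rbrakk>
      \<Longrightarrow> ip_dist (K n) (T n v) (T n w) = ip_dist (K n) v w"
  shows "ip_lipschitz bdd_seqs (\<lambda>\<xi> n. T n (\<xi> n))"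
proof -
  have T: "(\<lambda>n. T n (\<xi> n)) \<in> carrier bdd_seqs" if \<xi>: "\<xi> \<in> carrier bdd_seqs" for \<xi>
  proof -
    obtain a where a: "\<And>n. ip_norm (K n) (\<xi> n) \<le> a"
      using bounded_sequencesD(2)[OF \<xi>] by blast
    show ?thesis
      by (rule bounded_sequencesI[of _ a]) (use a in \<open>simp_all add: assms bounded_sequencesD(1)[OF \<xi>]\<close>)
  qed
  have "ip_dist bdd_seqs (\<lambda>n. T n (\<xi> n)) (\<lambda>n. T n (\<eta> n)) = ip_dist bdd_seqs \<xi> \<eta>"
    if \<xi>: "\<xi> \<in> carrier bdd_seqs" and \<eta>: "\<eta> \<in> carrier bdd_seqs" for \<xi> \<eta>
  proof (rule tendsto_unique[OF U_not_bot])
    show "((\<lambda>n. ip_dist (K n) (T n (\<xi> n)) (T n (\<eta> n)))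
        \<longlongrightarrow> ip_dist bdd_seqs (\<lambda>n. T n (\<xi> n)) (\<lambda>n. T n (\<eta> n))) U"
      by (rule tendsto_ip_dist_bounded_sequences[OF T[OF \<xi>] T[OF \<eta>]])
    show "((\<lambda>n. ip_dist (K n) (T n (\<xi> n)) (T n (\<eta> n))) \<longlongrightarrow> ip_dist bdd_seqs \<xi> \<eta>) U"
      using tendsto_ip_dist_bounded_sequences[OF \<xi> \<eta>]
      by (simp add: dist bounded_sequencesD(1)[OF \<xi>] bounded_sequencesD(1)[OF \<eta>])
  qed
  then show ?thesis
    using T by (auto simp: ip_lipschitz_def intro!: exI[of _ 1])
qed

end

section \<open>Square-summable functions on a finite set\<close>

lemma semi_ip_space_l2: "semi_ip_space (l2 X)"
proof (rule semi_ip_space.intro)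
  show "abelian_group (l2 X)"
  proof (rule abelian_groupI)
    fix \<xi> assume "\<xi> \<in> carrier (l2 X)"
    then show "\<exists>\<eta>\<in>carrier (l2 X). \<eta> \<oplus>\<^bsub>l2 X\<^esub> \<xi> = \<zero>\<^bsub>l2 X\<^esub>"
      by (intro bexI[of _ "\<lambda>x. - \<xi> x"]) (simp_all add: l2_def)
  qed (simp_all add: l2_def algebra_simps)
next
  show "semi_ip_space_axioms (l2 X)"
  proof
    fix \<xi> assume "\<xi> \<in> carrier (l2 X)"
    have "0 \<le> (\<Sum>x\<in>X. Re (\<xi> x * cnj (\<xi> x)))"
      by (intro sum_nonneg) simp
    then show "0 \<le> Re (ip (l2 X) \<xi> \<xi>)"
      by (simp add: l2_def)
  qed (simp_all add: l2_def algebra_simps sum.distrib sum_distrib_left)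
qed

lemma ip_norm_l2: "ip_norm (l2 X) \<xi> = sqrt (\<Sum>x\<in>X. (cmod (\<xi> x))\<^sup>2)"
  by (simp add: ip_norm_def l2_def cmod_power2 flip: power2_eq_square)

lemma ip_dist_l2:
  assumes "\<xi> \<in> carrier (l2 X)" "\<eta> \<in> carrier (l2 X)"
  shows "ip_dist (l2 X) \<xi> \<eta> = sqrt (\<Sum>x\<in>X. (cmod (\<xi> x - \<eta> x))\<^sup>2)"
proof -
  interpret semi_ip_space "l2 X"
    by (rule semi_ip_space_l2)
  have "\<xi> \<ominus>\<^bsub>l2 X\<^esub> \<eta> = (\<lambda>x. \<xi> x - \<eta> x)"
    using smult_minus_one[OF assms(2)] unfolding a_minus_def by (simp add: l2_def fun_eq_iff)
  then show ?thesis
    by (simp add: ip_dist_def ip_norm_l2)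
qed

section \<open>Invariant vectors and weak containment\<close>

lemma semi_ip_space_complex_line: "semi_ip_space complex_line"
proof (rule semi_ip_space.intro)
  show "abelian_group complex_line"
  proof (rule abelian_groupI)
    fix z assume "z \<in> carrier complex_line"
    show "\<exists>w\<in>carrier complex_line. w \<oplus>\<^bsub>complex_line\<^esub> z = \<zero>\<^bsub>complex_line\<^esub>"
      by (rule bexI[of _ "- z"]) (simp_all add: complex_line_def)
  qed (simp_all add: complex_line_def)
qed (unfold_locales, simp_all add: complex_line_def algebra_simps)

lemma ip_norm_complex_line: "ip_norm complex_line z = cmod z"
  by (simp add: ip_norm_def complex_line_def cmod_def power2_eq_square)

text \<open>The set \<open>D\<close> will be the carrier of \<open>H\<^sub>\<gamma>\<close>.  A sum in the structure restricted to \<open>D\<close> is a fold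
  that makes sense as long as all partial sums stay in \<open>D\<close>.  Here they stay on the line through
  \<open>v\<close>, so the sum can be read off from the inductive description of folding.\<close>
lemma (in semi_ip_space) finsum_multiples:
  assumes v: "v \<in> carrier H" and D: "\<And>c. c \<odot> v \<in> D"
    and A: "finite A" and f: "\<And>g. g \<in> A \<Longrightarrow> f g = a g \<odot> v"
  shows "finsum (H\<lparr>carrier := D\<rparr>) f A = (\<Sum>g\<in>A. a g) \<odot> v"
proof -
  let ?F = "foldSetD D (\<lambda>g y. f g \<oplus> y) \<zero>"
  have zero: "0 \<odot> v = \<zero>"
    using v by (rule smult_zero)
  have unique: "x = (\<Sum>g\<in>C. a g) \<odot> v" if "(C, x) \<in> ?F" "C \<subseteq> A" for C x
    using that
  proof (induction rule: foldSetD.induct)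
    case emptyI
    then show ?case by (simp add: zero)
  next
    case (insertI g C y)
    then show ?case
      using f foldSetD_imp_finite[OF insertI.hyps(3)] v by (simp add: smult_l_distr)
  qed
  have exists: "(C, (\<Sum>g\<in>C. a g) \<odot> v) \<in> ?F" if "finite C" "C \<subseteq> A" for C
    using that
  proof (induction rule: finite_induct)
    case empty
    then show ?case
      using D[of 0] by (simp add: zero foldSetD.emptyI)
  next
    case (insert g C)
    then have "f g \<oplus> (\<Sum>g\<in>C. a g) \<odot> v = (\<Sum>g\<in>insert g C. a g) \<odot> v"
      using f v by (simp add: smult_l_distr)
    with insert D show ?case
      using foldSetD.insertI[of g C "\<lambda>g y. f g \<oplus> y" "(\<Sum>g\<in>C. a g) \<odot> v" D \<zero>] by auto
  qed
  have "finsum (H\<lparr>carrier := D\<rparr>) f A = (THE x. (A, x) \<in> ?F)"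
    using A by (simp add: finsum_def finprod_def foldD_def comp_def)
  also have "\<dots> = (\<Sum>g\<in>A. a g) \<odot> v"
    using unique exists A by (intro the_equality) auto
  finally show ?thesis .
qed

text \<open>An element \<open>a\<close> of the group algebra acts on an invariant unit vector, as on the trivial
  representation, by the sum of its coefficients.\<close>
lemma (in semi_ip_space) invariant_vector_imp_weakly_contains_trivial:
  assumes v: "v \<in> carrier H" "ip_norm H v = 1" and D: "\<And>c. c \<odot> v \<in> D"
    and invariant: "\<And>g. g \<in> carrier G \<Longrightarrow> \<sigma> g v = v"
  shows "weakly_contains G (H\<lparr>carrier := D\<rparr>) \<sigma> complex_line trivial_rep"
  unfolding weakly_contains_def
proof
  fix a assume a: "a \<in> group_algebra G"
  define s where "s = (\<Sum>g\<in>{g. a g \<noteq> 0}. a g)"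
  interpret line: semi_ip_space complex_line
    by (rule semi_ip_space_complex_line)
  have "rep_extend (H\<lparr>carrier := D\<rparr>) \<sigma> a v = s \<odot> v"
    unfolding rep_extend_def s_def
    using a invariant by (intro finsum_multiples v D) (auto simp: group_algebra_def)
  then have norm: "ip_norm (H\<lparr>carrier := D\<rparr>) (rep_extend (H\<lparr>carrier := D\<rparr>) \<sigma> a v) = cmod s"
    using v ip_norm_smult[of v s] by (simp add: ip_norm_def)
  have "v \<in> D"
    using D[of 1] v by simp
  show "op_norm complex_line (rep_extend complex_line trivial_rep a)
      \<le> op_norm (H\<lparr>carrier := D\<rparr>) (rep_extend (H\<lparr>carrier := D\<rparr>) \<sigma> a)"
    unfolding op_norm_def
  proof (rule SUP_least)
    fix z assume z: "z \<in> {z \<in> carrier complex_line. ip_norm complex_line z \<le> 1}"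
    have "rep_extend complex_line trivial_rep a z = s * z"
      using line.finsum_multiples[of z "carrier complex_line" "{g. a g \<noteq> 0}" "\<lambda>g. a g * z" a] a z
      by (simp add: rep_extend_def s_def trivial_rep_def complex_line_def group_algebra_def)
    then have "ip_norm complex_line (rep_extend complex_line trivial_rep a z) \<le> cmod s"
      using z mult_left_le[of "cmod z" "cmod s"] by (simp add: ip_norm_complex_line norm_mult)
    also have "\<dots> = ip_norm (H\<lparr>carrier := D\<rparr>) (rep_extend (H\<lparr>carrier := D\<rparr>) \<sigma> a v)"
      by (simp add: norm)
    finally have "ereal (ip_norm complex_line (rep_extend complex_line trivial_rep a z))
        \<le> ereal (ip_norm (H\<lparr>carrier := D\<rparr>) (rep_extend (H\<lparr>carrier := D\<rparr>) \<sigma> a v))"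
      by simp
    also have "\<dots> \<le> (SUP v\<in>{v \<in> carrier (H\<lparr>carrier := D\<rparr>). ip_norm (H\<lparr>carrier := D\<rparr>) v \<le> 1}.
        ereal (ip_norm (H\<lparr>carrier := D\<rparr>) (rep_extend (H\<lparr>carrier := D\<rparr>) \<sigma> a v)))"
      using \<open>v \<in> D\<close> v by (intro SUP_upper) (simp add: ip_norm_def)
    finally show "ereal (ip_norm complex_line (rep_extend complex_line trivial_rep a z)) \<le> \<dots>" .
  qed
qed

section \<open>Folner sets in the coset spaces\<close>

lemma (in normal) l_coset_r_coset:
  assumes "g \<in> carrier G" "x \<in> carrier G"
  shows "g <# (H #> x) = H #> (g \<otimes> x)"
proof -
  have "g <# (H #> x) = (g <# H) #> x"
    using assms subset by (simp add: l_coset_eq_set_mult r_coset_eq_set_mult set_mult_assoc)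
  also have "\<dots> = H #> (g \<otimes> x)"
    using assms coset_eq subset by (simp add: coset_mult_assoc flip: coset_eq)
  finally show ?thesis .
qed

locale normal_sequence = group G for G (structure) +
  fixes N :: "nat \<Rightarrow> 'a set"
  assumes normal_N: "\<And>n. N n \<lhd> G"
begin

lemma coset_space_eq: "coset_space G N n = (\<lambda>x. N n #> x) ` carrier G"
  by (auto simp: coset_space_def FactGroup_def RCOSETS_def)

lemma translate_coset:
  "\<lbrakk>g \<in> carrier G; x \<in> carrier G\<rbrakk> \<Longrightarrow> g <# (N n #> x) = N n #> (g \<otimes> x)"
  using normal.l_coset_r_coset[OF normal_N] .

lemma bij_betw_translate:
  assumes "g \<in> carrier G"
  shows "bij_betw (\<lambda>x. g <# x) (coset_space G N n) (coset_space G N n)"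
  by (rule bij_betw_byWitness[of _ "\<lambda>x. inv g <# x"])
    (use assms in \<open>auto simp: coset_space_eq translate_coset inv_solve_left' simp flip: m_assoc\<close>)

lemma sum_translate:
  "g \<in> carrier G \<Longrightarrow> (\<Sum>x\<in>coset_space G N n. f (inv g <# x)) = (\<Sum>x\<in>coset_space G N n. f x)"
  using sum.reindex_bij_betw[OF bij_betw_translate[of "inv g"]] by simp

lemma quasi_regular_in_l2: "quasi_regular G N n g \<xi> \<in> carrier (l2 (coset_space G N n))"
  by (simp add: quasi_regular_def l2_def)

lemma ip_norm_quasi_regular:
  assumes "g \<in> carrier G"
  shows "ip_norm (l2 (coset_space G N n)) (quasi_regular G N n g \<xi>)
    = ip_norm (l2 (coset_space G N n)) \<xi>"
  using sum_translate[OF assms, where n = n and f = "\<lambda>x. (cmod (\<xi> x))\<^sup>2"]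
  by (simp add: ip_norm_l2 quasi_regular_def)

lemma ip_dist_quasi_regular:
  assumes "g \<in> carrier G" "\<xi> \<in> carrier (l2 (coset_space G N n))"
    "\<eta> \<in> carrier (l2 (coset_space G N n))"
  shows "ip_dist (l2 (coset_space G N n)) (quasi_regular G N n g \<xi>) (quasi_regular G N n g \<eta>)
    = ip_dist (l2 (coset_space G N n)) \<xi> \<eta>"
  using sum_translate[OF assms(1), where n = n and f = "\<lambda>x. (cmod (\<xi> x - \<eta> x))\<^sup>2"] assms
  by (simp add: ip_dist_l2 quasi_regular_in_l2) (simp add: quasi_regular_def)

text \<open>The Folner condition makes the normalised indicator functions of the sets \<open>A n\<close>
  asymptotically invariant.  Passing to the ultraproduct turns this into exact invariance.\<close>
theorem folner_sets_imp_weakly_contains_trivial: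
  assumes U: "nonprincipal_ultrafilter U"
    and finite: "\<And>n. finite (coset_space G N n)"
    and A: "\<And>n. A n \<subseteq> coset_space G N n" "\<And>n. A n \<noteq> {}" "\<And>n. card (A n) \<le> \<gamma> n"
    and folner: "\<And>g. g \<in> carrier G \<Longrightarrow>
      (\<lambda>n. real (card {x \<in> coset_space G N n. (inv g <# x \<in> A n) \<noteq> (x \<in> A n)}) / real (card (A n)))
        \<longlonglongrightarrow> 0"
  shows "weakly_contains G (H_growth G N U \<gamma>) (pi_growth G N U \<gamma>) complex_line trivial_rep"
proof -
  let ?X = "coset_space G N" and ?H = "H_tilde G N U"
  let ?K = "\<lambda>n. l2 (?X n)"
  let ?T = "\<lambda>g \<xi> n. quasi_regular G N n g (\<xi> n)"
  interpret semi_ip_ultraproduct U ?K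
    by (rule semi_ip_ultraproduct.intro) (simp_all only: U semi_ip_space_l2)
  interpret H: semi_ip_space ?H
    unfolding H_tilde_def by (rule semi_ip_space_bounded_sequences)
  interpret Q: semi_ip_space "sep_quotient ?H"
    by (rule H.semi_ip_space_sep_quotient)
  interpret hat: semi_ip_space "H_hat G N U"
    unfolding H_hat_def by (rule Q.semi_ip_space_completion)
  have card: "card (A n) > 0" for n
    using A(1,2) finite by (meson card_gt_0_iff finite_subset)
  \<comment> \<open>Scaled so that the norm of each \<open>\<xi> n\<close> is \<open>1\<close>; the squared distance between \<open>\<xi> n\<close> and its
    translate is then the proportion that appears in the Folner condition.\<close>
  define \<xi> where "\<xi> = (\<lambda>n x. if x \<in> A n then complex_of_real (1 / sqrt (card (A n))) else 0)"
  have sq: "(cmod (\<xi> n x))\<^sup>2 = (if x \<in> A n then 1 / card (A n) else 0)" for n x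
    by (simp add: \<xi>_def norm_divide power_divide)
  have "(\<Sum>x\<in>?X n. (cmod (\<xi> n x))\<^sup>2) = (\<Sum>x\<in>A n. 1 / card (A n))" for n
    using finite A(1) by (simp add: sq sum.If_cases Int_absorb1 flip: sum.inter_restrict)
  then have norm: "ip_norm (?K n) (\<xi> n) = 1" for n
    using card[of n] by (simp add: ip_norm_l2)
  have in_l2: "\<xi> n \<in> carrier (?K n)" for n
    using A(1) by (auto simp: \<xi>_def l2_def)
  have \<xi>: "\<xi> \<in> carrier ?H"
    using norm in_l2 unfolding H_tilde_def by (intro bounded_sequencesI[of _ 1]) simp_all
  have "((\<lambda>n. ip_norm (?K n) (\<xi> n)) \<longlongrightarrow> ip_norm ?H \<xi>) U"
    using tendsto_ip_norm_bounded_sequences \<xi> unfolding H_tilde_def .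
  then have norm_\<xi>: "ip_norm ?H \<xi> = 1"
    by (simp add: norm tendsto_const_iff)
  have lipschitz: "ip_lipschitz ?H (?T g)" if "g \<in> carrier G" for g
    unfolding H_tilde_def using that
    by (intro ip_lipschitz_bounded_sequences)
      (simp_all add: quasi_regular_in_l2 ip_norm_quasi_regular ip_dist_quasi_regular)
  have invariant: "sep_class ?H (?T g \<xi>) = sep_class ?H \<xi>" if g: "g \<in> carrier G" for g
  proof -
    let ?S = "\<lambda>n. {x \<in> ?X n. (inv g <# x \<in> A n) \<noteq> (x \<in> A n)}"
    have T\<xi>: "?T g \<xi> \<in> carrier ?H"
      using lipschitz[OF g] \<xi> by (auto simp: ip_lipschitz_def)
    have "ip_dist (?K n) (?T g \<xi> n) (\<xi> n) = sqrt (card (?S n) / card (A n))" for n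
    proof -
      have "ip_dist (?K n) (?T g \<xi> n) (\<xi> n)
          = sqrt (\<Sum>x\<in>?X n. (cmod (\<xi> n (inv g <# x) - \<xi> n x))\<^sup>2)"
        using in_l2 by (simp add: ip_dist_l2 quasi_regular_in_l2) (simp add: quasi_regular_def)
      also have "(\<Sum>x\<in>?X n. (cmod (\<xi> n (inv g <# x) - \<xi> n x))\<^sup>2)
          = (\<Sum>x\<in>?X n. if (inv g <# x \<in> A n) \<noteq> (x \<in> A n) then 1 / card (A n) else 0)"
        by (intro sum.cong) (auto simp: \<xi>_def power_divide norm_divide)
      also have "\<dots> = card (?S n) / card (A n)"
        using finite by (simp add: sum.If_cases Int_def flip: sum.inter_filter)
      finally show ?thesis .
    qed
    moreover have "(\<lambda>n. sqrt (card (?S n) / card (A n))) \<longlonglongrightarrow> sqrt 0"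
      by (intro tendsto_real_sqrt folner g)
    ultimately have "((\<lambda>n. ip_dist (?K n) (?T g \<xi> n) (\<xi> n)) \<longlongrightarrow> 0) U"
      using tendsto_mono[OF nonprincipal_ultrafilter_le_sequentially[OF U]] by simp
    moreover have "((\<lambda>n. ip_dist (?K n) (?T g \<xi> n) (\<xi> n)) \<longlongrightarrow> ip_dist ?H (?T g \<xi>) \<xi>) U"
      using tendsto_ip_dist_bounded_sequences T\<xi> \<xi> unfolding H_tilde_def .
    ultimately have "ip_dist ?H (?T g \<xi>) \<xi> = 0"
      using tendsto_unique[OF U_not_bot] by blast
    then show ?thesis
      using T\<xi> \<xi> by (simp add: H.sep_class_eq_iff)
  qed
  define v where "v = H_hat_emb G N U \<xi>"
  have v: "v \<in> carrier (H_hat G N U)" "ip_norm (H_hat G N U) v = 1"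
    using \<xi> norm_\<xi> by (simp_all add: v_def H_hat_def H_hat_emb_def Q.ip_norm_completion_emb
        H.ip_norm_sep_class)
  let ?D = "carrier (H_growth G N U \<gamma>)"
  have D: "c \<odot>\<^bsub>H_hat G N U\<^esub> v \<in> ?D" for c
  proof -
    have c\<xi>: "c \<odot>\<^bsub>?H\<^esub> \<xi> \<in> carrier ?H"
      using \<xi> by simp
    have eq: "c \<odot>\<^bsub>H_hat G N U\<^esub> v = H_hat_emb G N U (c \<odot>\<^bsub>?H\<^esub> \<xi>)"
      using \<xi> by (simp add: v_def H_hat_def H_hat_emb_def Q.completion_emb_smult H.sep_class_smult)
    \<comment> \<open>Multiples of \<open>\<xi>\<close> keep its support, so the multiplicity \<open>k = 1\<close> will do.\<close>
    have "card {x. (c \<odot>\<^bsub>?H\<^esub> \<xi>) n x \<noteq> 0} \<le> 1 * \<gamma> n" for n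
    proof -
      have "{x. (c \<odot>\<^bsub>?H\<^esub> \<xi>) n x \<noteq> 0} \<subseteq> A n"
        by (auto simp: H_tilde_def bounded_sequences_def l2_def \<xi>_def)
      then have "card {x. (c \<odot>\<^bsub>?H\<^esub> \<xi>) n x \<noteq> 0} \<le> card (A n)"
        using card[of n] by (intro card_mono) (auto simp: card_gt_0_iff)
      then show ?thesis
        using A(3)[of n] by simp
    qed
    then have "c \<odot>\<^bsub>?H\<^esub> \<xi> \<in> H_tilde_growth G N U \<gamma>"
      using c\<xi> unfolding H_tilde_growth_def by blast
    then have mem: "c \<odot>\<^bsub>H_hat G N U\<^esub> v \<in> H_hat_emb G N U ` H_tilde_growth G N U \<gamma>"
      unfolding eq by (rule imageI)
    have hat_mem: "c \<odot>\<^bsub>H_hat G N U\<^esub> v \<in> carrier (H_hat G N U)"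
      using v by simp
    have "\<exists>w\<in>H_hat_emb G N U ` H_tilde_growth G N U \<gamma>.
        ip_dist (H_hat G N U) (c \<odot>\<^bsub>H_hat G N U\<^esub> v) w < r" if "r > 0" for r
      using mem by (rule bexI[rotated]) (simp add: hat_mem that)
    then show ?thesis
      using hat_mem by (simp add: H_growth_def ip_closure_def)
  qed
  have "pi_growth G N U \<gamma> g v = v" if g: "g \<in> carrier G" for g
  proof -
    have "v \<in> ?D"
      using D[of 1] v by simp
    then have "pi_growth G N U \<gamma> g v = lambda_hat G N U g v"
      by (simp add: pi_growth_def)
    also have "\<dots> = v"
      using \<xi> g lipschitz
      by (simp add: v_def lambda_hat_def H_hat_emb_def Q.completion_map_emb H.ip_lipschitz_sep_map
          H.sep_map_class invariant)
    finally show ?thesis .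
  qed
  then have "weakly_contains G ((H_hat G N U)\<lparr>carrier := ?D\<rparr>) (pi_growth G N U \<gamma>)
      complex_line trivial_rep"
    using v D by (intro hat.invariant_vector_imp_weakly_contains_trivial)
  then show ?thesis
    by (simp add: H_growth_def)
qed

end

section \<open>The series of subgroups generated by squares\<close>

context group
begin

lemma normal_squares_subgroup:
  assumes "K \<lhd> G"
  shows "squares_subgroup G K \<lhd> G"
  unfolding squares_subgroup_def
proof (rule normal_generateI)
  interpret K: normal K G by (rule assms)
  show "(\<lambda>x. x \<otimes> x) ` K \<subseteq> carrier G"
    using K.subset by auto
  fix h g assume "h \<in> (\<lambda>x. x \<otimes> x) ` K" and g: "g \<in> carrier G"
  then obtain x where x: "x \<in> K" "h = x \<otimes> x"
    by blast
  have "inv g \<otimes> (g \<otimes> (x \<otimes> inv g)) = x \<otimes> inv g"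
    using g x K.subset by (simp add: subset_iff flip: m_assoc)
  then have "g \<otimes> h \<otimes> inv g = (g \<otimes> x \<otimes> inv g) \<otimes> (g \<otimes> x \<otimes> inv g)"
    using g x K.subset by (simp add: subset_iff m_assoc)
  then show "g \<otimes> h \<otimes> inv g \<in> (\<lambda>x. x \<otimes> x) ` K"
    using K.inv_op_closed2[OF g x(1)] by blast
qed

lemma squares_subgroup_subset:
  assumes "subgroup K G"
  shows "squares_subgroup G K \<subseteq> K"
  unfolding squares_subgroup_def
  using assms by (intro generate_subgroup_incl) (auto intro: subgroup.m_closed)

text \<open>By induction, left multiplication by any element of the generated subgroup preserves \<open>Y\<close>, and it
  takes \<open>\<one>\<close> to that element.  The lemma is used to exhaust a group by products of representatives.\<close>
lemma generate_subset_left_invariant: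
  assumes "S \<subseteq> carrier G" "Y \<subseteq> carrier G" "\<one> \<in> Y"
    and "\<And>s y. \<lbrakk>s \<in> S; y \<in> Y\<rbrakk> \<Longrightarrow> s \<otimes> y \<in> Y"
    and "\<And>s y. \<lbrakk>s \<in> S; y \<in> Y\<rbrakk> \<Longrightarrow> inv s \<otimes> y \<in> Y"
  shows "generate G S \<subseteq> Y"
proof
  fix h assume h: "h \<in> generate G S"
  then have "\<forall>y\<in>Y. h \<otimes> y \<in> Y"
  proof (induction h rule: generate.induct)
    case (eng h1 h2)
    then have "h1 \<in> carrier G" "h2 \<in> carrier G"
      using generate_incl[OF assms(1)] by auto
    with eng.IH show ?case
      using assms(2) by (auto simp: subset_iff m_assoc)
  qed (use assms in \<open>auto simp: subset_iff\<close>)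
  then show "h \<in> Y"
    using assms(3) h generate_in_carrier[OF assms(1)] by fastforce
qed

text \<open>Every element is its own inverse, and inversion reverses products.\<close>
lemma exponent_two_commute:
  assumes "subgroup M G" "\<And>x. x \<in> M \<Longrightarrow> x \<otimes> x = \<one>" "x \<in> M" "y \<in> M"
  shows "x \<otimes> y = y \<otimes> x"
proof -
  have c: "x \<in> carrier G" "y \<in> carrier G" "x \<otimes> y \<in> M"
    using assms subgroup.mem_carrier subgroup.m_closed by metis+
  then have "inv x = x" "inv y = y" "inv (x \<otimes> y) = x \<otimes> y"
    using assms by (simp_all add: inv_equality)
  then show ?thesis
    using inv_mult_group[OF c(1,2)] by simp
qed

text \<open>The set \<open>P\<close> consists of the products of the subsets of \<open>E\<close>, built up one element at a
  time: a new factor commutes with the earlier ones and cancels against itself.\<close>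
lemma exponent_two_finite_invariant_set:
  assumes M: "subgroup M G" "\<And>x. x \<in> M \<Longrightarrow> x \<otimes> x = \<one>" and E: "finite E" "E \<subseteq> M"
  shows "\<exists>P. finite P \<and> P \<subseteq> M \<and> \<one> \<in> P \<and> (\<forall>x\<in>E. \<forall>p\<in>P. x \<otimes> p \<in> P)"
  using E
proof (induction E rule: finite_induct)
  case empty
  then show ?case
    using subgroup.one_closed[OF M(1)] by (intro exI[of _ "{\<one>}"]) simp
next
  case (insert x E)
  then obtain P where P: "finite P" "P \<subseteq> M" "\<one> \<in> P" "\<And>y p. \<lbrakk>y \<in> E; p \<in> P\<rbrakk> \<Longrightarrow> y \<otimes> p \<in> P"
    by auto
  have x: "x \<in> M" and E: "E \<subseteq> M"
    using insert.prems by auto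
  have carrier: "y \<in> carrier G" if "y \<in> M" for y
    using that M(1) subgroup.mem_carrier by fast
  have "y \<otimes> p \<in> P \<union> (\<lambda>p. x \<otimes> p) ` P"
    if y: "y \<in> insert x E" and p: "p \<in> P \<union> (\<lambda>p. x \<otimes> p) ` P" for y p
  proof -
    consider "y = x" "p \<in> P" | q where "y = x" "q \<in> P" "p = x \<otimes> q" | "y \<in> E" "p \<in> P"
      | q where "y \<in> E" "q \<in> P" "p = x \<otimes> q"
      using y p by auto
    then show ?thesis
    proof cases
      case 2
      then have "y \<otimes> p = q"
        using M(2)[OF x] x P(2) carrier by (auto simp: subset_iff simp flip: m_assoc)
      with 2 show ?thesis by simp
    next
      case 4
      have "y \<otimes> p = (y \<otimes> x) \<otimes> q"
        using 4 x E P(2) carrier by (auto simp: subset_iff m_assoc)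
      also have "\<dots> = (x \<otimes> y) \<otimes> q"
        using exponent_two_commute[OF M, of y x] 4 x E by auto
      also have "\<dots> = x \<otimes> (y \<otimes> q)"
        using 4 x E P(2) carrier by (auto simp: subset_iff m_assoc)
      finally show ?thesis
        using P(4) 4 by auto
    qed (use P(4) in auto)
  qed
  moreover have "P \<union> (\<lambda>p. x \<otimes> p) ` P \<subseteq> M"
    using P(2) x subgroup.m_closed[OF M(1)] by auto
  ultimately show ?case
    using P(1,3) by (intro exI[of _ "P \<union> (\<lambda>p. x \<otimes> p) ` P"]) auto
qed

text \<open>Schreier's argument.  With \<open>r\<close> choosing coset representatives from the finite set \<open>T\<close>, a
  generator \<open>s\<close> moves a representative \<open>t\<close> to \<open>r (s \<otimes> t)\<close> times an element of \<open>M\<close>, and only finitely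
  many elements of \<open>M\<close> arise in this way.  If \<open>P\<close> is a finite subset of \<open>M\<close> that is stable under
  them, then the products of \<open>T\<close> and \<open>P\<close> are stable under the generators and exhaust the group.\<close>
lemma finite_if_exponent_two_finite_index:
  assumes S: "finite S" "S \<subseteq> carrier G" "generate G S = carrier G"
    and M: "subgroup M G" "\<And>x. x \<in> M \<Longrightarrow> x \<otimes> x = \<one>"
    and T: "finite T" "T \<subseteq> carrier G" "\<And>g. g \<in> carrier G \<Longrightarrow> \<exists>t\<in>T. inv t \<otimes> g \<in> M"
  shows "finite (carrier G)"
proof -
  obtain r where r: "\<And>g. g \<in> carrier G \<Longrightarrow> r g \<in> T" "\<And>g. g \<in> carrier G \<Longrightarrow> inv (r g) \<otimes> g \<in> M"
    using T(3) by metis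
  \<comment> \<open>The additional \<open>\<one>\<close> in both factors lets the case \<open>s = t = \<one>\<close> below show that \<open>\<one>\<close> is a
    product of an element of \<open>T\<close> and one of \<open>P\<close>, although \<open>\<one>\<close> may fail to lie in \<open>T\<close>.\<close>
  define S' where "S' = insert \<one> (S \<union> m_inv G ` S)"
  define E where "E = (\<lambda>(s, t). inv (r (s \<otimes> t)) \<otimes> (s \<otimes> t)) ` (S' \<times> insert \<one> T)"
  have S': "finite S'" "S' \<subseteq> carrier G"
    using S(1,2) by (auto simp: S'_def)
  have "finite E" "E \<subseteq> M"
    using S' T(1,2) by (auto simp: E_def subset_iff intro!: r(2))
  then obtain P where P: "finite P" "P \<subseteq> M" "\<one> \<in> P" "\<And>x p. \<lbrakk>x \<in> E; p \<in> P\<rbrakk> \<Longrightarrow> x \<otimes> p \<in> P"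
    using exponent_two_finite_invariant_set[OF M] by metis
  have P_carrier: "P \<subseteq> carrier G"
    using P(2) subgroup.subset[OF M(1)] by blast
  define Y where "Y = (\<lambda>(t, p). t \<otimes> p) ` (T \<times> P)"
  have step: "s \<otimes> (t \<otimes> p) \<in> Y" if "s \<in> S'" "t \<in> insert \<one> T" "p \<in> P" for s t p
  proof -
    have c: "s \<in> carrier G" "t \<in> carrier G" "p \<in> carrier G" "r (s \<otimes> t) \<in> carrier G"
      using that S' T(2) P_carrier r(1)[of "s \<otimes> t"] by auto
    have "r (s \<otimes> t) \<otimes> (inv (r (s \<otimes> t)) \<otimes> (s \<otimes> (t \<otimes> p))) = s \<otimes> (t \<otimes> p)"
      using c by (simp flip: m_assoc)
    then have "s \<otimes> (t \<otimes> p) = r (s \<otimes> t) \<otimes> ((inv (r (s \<otimes> t)) \<otimes> (s \<otimes> t)) \<otimes> p)"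
      using c by (simp add: m_assoc)
    moreover have "inv (r (s \<otimes> t)) \<otimes> (s \<otimes> t) \<in> E"
      using that unfolding E_def by (intro image_eqI[of _ _ "(s, t)"]) auto
    then have "(inv (r (s \<otimes> t)) \<otimes> (s \<otimes> t)) \<otimes> p \<in> P"
      using P(4) that(3) by blast
    ultimately show ?thesis
      using r(1)[of "s \<otimes> t"] c unfolding Y_def by auto
  qed
  have "generate G S \<subseteq> Y"
  proof (rule generate_subset_left_invariant)
    show "\<one> \<in> Y"
      using step[of \<one> \<one> \<one>] P(3) by (simp add: S'_def)
    show "Y \<subseteq> carrier G"
      using T(2) P_carrier by (auto simp: Y_def)
    show "s \<otimes> y \<in> Y" if "s \<in> S" "y \<in> Y" for s y
      using that step[of s] by (auto simp: Y_def S'_def)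
    show "inv s \<otimes> y \<in> Y" if "s \<in> S" "y \<in> Y" for s y
      using that step[of "inv s"] by (auto simp: Y_def S'_def)
  qed (rule S(2))
  then show ?thesis
    using S(3) T(1) P(1) finite_subset[of "carrier G" Y] by (simp add: Y_def)
qed

text \<open>In the quotient by the subgroup generated by the squares of \<open>K\<close>, the image of \<open>K\<close> has
  exponent two and finite index.\<close>
lemma finite_index_squares_subgroup:
  assumes S: "finite S" "S \<subseteq> carrier G" "generate G S = carrier G"
    and K: "K \<lhd> G" "finite (carrier (G Mod K))"
  shows "finite (carrier (G Mod squares_subgroup G K))"
proof -
  define L where "L = squares_subgroup G K"
  interpret K: normal K G by (rule K(1))
  interpret L: normal L G
    unfolding L_def by (rule normal_squares_subgroup[OF K(1)])
  interpret Q: group "G Mod L"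
    by (rule L.factorgroup_is_group)
  interpret \<phi>: group_hom G "G Mod L" "\<lambda>x. L #> x"
    by unfold_locales (rule L.r_coset_hom_Mod)
  have "carrier (G Mod K) = (\<lambda>x. K #> x) ` carrier G"
    by (auto simp: FactGroup_def RCOSETS_def)
  then have "finite ((\<lambda>x. K #> x) ` carrier G)"
    using K(2) by simp
  then obtain T where T: "T \<subseteq> carrier G" "finite T" "(\<lambda>x. K #> x) ` carrier G = (\<lambda>x. K #> x) ` T"
    using finite_subset_image[OF _ subset_refl, of "\<lambda>x. K #> x" "carrier G"] by metis
  have "finite (carrier (G Mod L))"
  proof (rule Q.finite_if_exponent_two_finite_index)
    show "finite ((\<lambda>x. L #> x) ` S)" "finite ((\<lambda>x. L #> x) ` T)"
      using S(1) T(2) by simp_all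
    show "(\<lambda>x. L #> x) ` S \<subseteq> carrier (G Mod L)" "(\<lambda>x. L #> x) ` T \<subseteq> carrier (G Mod L)"
      using S(2) T(1) by auto
    have "carrier (G Mod L) = (\<lambda>x. L #> x) ` carrier G"
      by (auto simp: FactGroup_def RCOSETS_def)
    then show "generate (G Mod L) ((\<lambda>x. L #> x) ` S) = carrier (G Mod L)"
      using \<phi>.generate_img[OF S(2)] S(3) by simp
    show "subgroup ((\<lambda>x. L #> x) ` K) (G Mod L)"
      by (rule \<phi>.subgroup_img_is_subgroup) (rule K.subgroup_axioms)
    show "A \<otimes>\<^bsub>G Mod L\<^esub> A = \<one>\<^bsub>G Mod L\<^esub>" if A: "A \<in> (\<lambda>x. L #> x) ` K" for A
    proof -
      obtain x where x: "x \<in> K" "A = L #> x"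
        using A by blast
      have xc: "x \<in> carrier G"
        using K.mem_carrier[OF x(1)] .
      have "A \<otimes>\<^bsub>G Mod L\<^esub> A = L #> (x \<otimes> x)"
        unfolding x(2) by (rule \<phi>.hom_mult[OF xc xc, symmetric])
      also have "\<dots> = L"
      proof (rule coset_join2)
        show "x \<otimes> x \<in> L"
          unfolding L_def squares_subgroup_def using x(1) by (intro generate.incl imageI)
      qed (use xc L.subgroup_axioms in simp_all)
      finally show ?thesis
        by (simp add: FactGroup_def)
    qed
    show "\<exists>B\<in>(\<lambda>x. L #> x) ` T. inv\<^bsub>G Mod L\<^esub> B \<otimes>\<^bsub>G Mod L\<^esub> A \<in> (\<lambda>x. L #> x) ` K"
      if A: "A \<in> carrier (G Mod L)" for A
    proof -
      obtain g where g: "g \<in> carrier G" "A = L #> g"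
        using A by (auto simp: FactGroup_def RCOSETS_def)
      then obtain t where t: "t \<in> T" "K #> g = K #> t"
        using T(3) by (metis imageE imageI)
      have tc: "t \<in> carrier G"
        using t T(1) by blast
      have "g \<in> K #> t"
        using rcos_self[OF g(1) K.subgroup_axioms] t(2) by simp
      then obtain k where k: "k \<in> K" "g = k \<otimes> t"
        by (auto simp: r_coset_def)
      have "inv t \<otimes> g \<in> K"
        using K.inv_op_closed1[OF tc k(1)] k tc K.subset by (auto simp: m_assoc)
      moreover have "inv\<^bsub>G Mod L\<^esub> (L #> t) \<otimes>\<^bsub>G Mod L\<^esub> A = L #> (inv t \<otimes> g)"
        unfolding g(2) \<phi>.hom_inv[OF tc, symmetric]
        by (rule \<phi>.hom_mult[OF inv_closed[OF tc] g(1), symmetric])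
      ultimately show ?thesis
        using t(1) by blast
    qed
  qed
  then show ?thesis
    by (simp add: L_def)
qed

lemma normal_squares_series: "squares_series G n \<lhd> G"
proof (induction n)
  case 0
  show ?case
    by (simp, rule normal_invI) (auto simp: subgroup_self)
qed (simp add: normal_squares_subgroup)

end

section \<open>Level sets of an integer-valued homomorphism\<close>

text \<open>Shifting an interval modulo \<open>M\<close> by \<open>d\<close> changes membership only for residues within distance
  \<open>|d|\<close> of one of its two end points.\<close>
lemma card_shift_symmetric_difference:
  fixes d L M :: int
  assumes "0 < L" "L \<le> M"
  shows "card {i \<in> {0..<M}. ((i - d) mod M < L) \<noteq> (i < L)} \<le> nat (4 * \<bar>d\<bar> + 2)"
proof -
  have "{i \<in> {0..<M}. ((i - d) mod M < L) \<noteq> (i < L)}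
      \<subseteq> (\<lambda>j. j mod M) ` ({- \<bar>d\<bar>..\<bar>d\<bar>} \<union> {L - \<bar>d\<bar>..L + \<bar>d\<bar>})" (is "?B \<subseteq> ?f ` ?J")
  proof
    fix i assume i: "i \<in> ?B"
    then have iM: "i mod M = i" "(i - M) mod M = i"
      by auto
    show "i \<in> ?f ` ?J"
    proof (cases "i \<in> ?J \<or> i - M \<in> ?J")
      case True
      then show ?thesis
        using iM by force
    next
      case False
      then have "0 \<le> i - d" "i - d < M"
        using i assms by auto
      then have "(i - d) mod M = i - d"
        by simp
      then show ?thesis
        using False i assms by auto
    qed
  qed
  then have "card ?B \<le> card ?J"
    by (rule surj_card_le[rotated]) simp
  also have "\<dots> \<le> card {- \<bar>d\<bar>..\<bar>d\<bar>} + card {L - \<bar>d\<bar>..L + \<bar>d\<bar>}"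
    by (rule card_Un_le)
  also have "\<dots> = nat (4 * \<bar>d\<bar> + 2)"
    by simp
  finally show ?thesis .
qed

lemma power_half_tendsto_0: "(\<lambda>n. K * (1 / 2 :: real) ^ (n div 2)) \<longlonglongrightarrow> 0"
proof -
  have "filterlim (\<lambda>n :: nat. n div 2) sequentially sequentially"
    unfolding filterlim_at_top
  proof
    fix m :: nat
    show "\<forall>\<^sub>F n in sequentially. m \<le> n div 2"
      using eventually_ge_at_top[of "2 * m"] by eventually_elim auto
  qed
  then have "(\<lambda>n. (1 / 2 :: real) ^ (n div 2)) \<longlonglongrightarrow> 0"
    by (rule filterlim_compose[OF LIMSEQ_realpow_zero, rotated -1]) simp_all
  then show ?thesis
    using tendsto_mult_right_zero by blast
qed

locale fg_group_onto_int = group G for G (structure) +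
  fixes S :: "'a set" and e :: "'a \<Rightarrow> int" and a :: 'a
  assumes S: "finite S" "S \<subseteq> carrier G" "generate G S = carrier G"
    and e_mult: "\<lbrakk>x \<in> carrier G; y \<in> carrier G\<rbrakk> \<Longrightarrow> e (x \<otimes> y) = e x + e y"
    and a: "a \<in> carrier G" "e a = 1"
begin

abbreviation N :: "nat \<Rightarrow> 'a set" where
  "N \<equiv> squares_series G"

abbreviation X :: "nat \<Rightarrow> 'a set set" where
  "X \<equiv> coset_space G N"

sublocale normal_sequence G N
  by (intro normal_sequence.intro normal_sequence_axioms.intro group_axioms normal_squares_series)

lemma subgroup_N: "subgroup (N n) G"
  using normal_imp_subgroup[OF normal_N] .

lemma N_carrier: "x \<in> N n \<Longrightarrow> x \<in> carrier G"
  using subgroup.mem_carrier[OF subgroup_N] .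

lemma N_Suc_subset: "N (Suc n) \<subseteq> N n"
  using squares_subgroup_subset[OF subgroup_N] by simp

lemma finite_X: "finite (X n)"
proof (induction n)
  case 0
  have "X 0 \<subseteq> {carrier G}"
    using coset_join2[OF _ subgroup_self] by (auto simp: coset_space_eq)
  then show ?case
    by (rule finite_subset) simp
next
  case (Suc n)
  then show ?case
    using finite_index_squares_subgroup[OF S normal_N] by (simp add: coset_space_def)
qed

lemma e_one: "e \<one> = 0"
  using e_mult[of \<one> \<one>] by simp

lemma e_inv: "x \<in> carrier G \<Longrightarrow> e (inv x) = - e x"
  using e_mult[of "inv x" x] by (simp add: e_one)

lemma e_pow: "e (a [^] (k :: nat)) = int k"
  by (induction k) (simp_all add: e_one e_mult a)

text \<open>The reason why the whole construction works: \<open>e\<close> doubles on squares, so it is defined modulo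
  \<open>2\<^sup>n\<close> on the cosets of \<open>N n\<close>.\<close>
lemma dvd_e_N: "x \<in> N n \<Longrightarrow> 2 ^ n dvd e x"
proof (induction n arbitrary: x)
  case (Suc n)
  from Suc.prems have "x \<in> generate G ((\<lambda>x. x \<otimes> x) ` N n)"
    by (simp add: squares_subgroup_def)
  then show ?case
  proof (induction x rule: generate.induct)
    case (incl h)
    then show ?case
      using Suc.IH by (auto simp: e_mult N_carrier simp flip: mult_2)
  next
    case (inv h)
    then show ?case
      using Suc.IH by (auto simp: e_mult e_inv N_carrier simp flip: mult_2)
  next
    case (eng h1 h2)
    moreover have "(\<lambda>x. x \<otimes> x) ` N n \<subseteq> carrier G"
      using N_carrier by auto
    ultimately have "h1 \<in> carrier G" "h2 \<in> carrier G"
      using generate_in_carrier by blast+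
    with eng.IH show ?case
      by (simp add: e_mult)
  qed (simp add: e_one)
qed simp

lemma pow_in_N: "a [^] ((2 :: nat) ^ n) \<in> N n"
proof (induction n)
  case (Suc n)
  have "a [^] ((2 :: nat) ^ Suc n) = a [^] ((2 :: nat) ^ n) \<otimes> a [^] ((2 :: nat) ^ n)"
    using a by (simp add: nat_pow_mult mult_2)
  then show ?case
    using Suc by (auto simp: squares_subgroup_def intro!: generate.incl)
qed (simp add: a)

lemma coset_absorb: "\<lbrakk>k \<in> N n; x \<in> carrier G\<rbrakk> \<Longrightarrow> N n #> (k \<otimes> x) = N n #> x"
  using coset_mult_assoc[of "N n" k x] coset_join2[OF _ subgroup_N] N_carrier
  by (simp add: subset_iff)

definition rep :: "'a set \<Rightarrow> 'a" where
  "rep A = (SOME x. x \<in> A)"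

lemma rep_coset:
  assumes "x \<in> carrier G"
  obtains k where "k \<in> N n" "rep (N n #> x) = k \<otimes> x"
proof -
  have "rep (N n #> x) \<in> N n #> x"
    unfolding rep_def by (rule someI) (rule rcos_self[OF assms subgroup_N])
  then show ?thesis
    using that by (auto simp: r_coset_def)
qed

text \<open>For cosets of \<open>N n\<close> the choice of the representative does not matter, by the divisibility just
  shown.\<close>
definition level :: "nat \<Rightarrow> 'a set \<Rightarrow> int" where
  "level n A = e (rep A) mod 2 ^ n"

lemma level_coset:
  assumes x: "x \<in> carrier G"
  shows "level n (N n #> x) = e x mod 2 ^ n"
proof -
  obtain k where k: "k \<in> N n" "rep (N n #> x) = k \<otimes> x"
    using rep_coset[OF x] .
  then have "level n (N n #> x) = (e k + e x) mod 2 ^ n"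
    using x N_carrier by (simp add: level_def e_mult)
  also have "\<dots> = e x mod 2 ^ n"
    using dvd_e_N[OF k(1)] by (auto elim: dvdE)
  finally show ?thesis .
qed

lemma level_range: "level n A \<in> {0..<2 ^ n}"
  by (simp add: level_def)

lemma level_translate:
  "\<lbrakk>g \<in> carrier G; A \<in> X n\<rbrakk> \<Longrightarrow> level n (g <# A) = (e g + level n A) mod 2 ^ n"
  by (auto simp: coset_space_eq translate_coset level_coset e_mult mod_simps)

definition level_size :: "nat \<Rightarrow> nat" where
  "level_size n = card {A \<in> X n. level n A = 0}"

text \<open>Translation by a preimage of \<open>i\<close> under \<open>e\<close> maps level \<open>0\<close> bijectively onto level \<open>i\<close>.\<close>
lemma card_level:
  assumes "i \<in> {0..<2 ^ n}"
  shows "card {A \<in> X n. level n A = i} = level_size n"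
proof -
  obtain k :: nat where "i = int k"
    using assms zero_le_imp_eq_int by auto
  then obtain g where g: "g \<in> carrier G" "e g = i"
    using a e_pow[of k] by (metis nat_pow_closed)
  have bij: "bij_betw (\<lambda>A. g <# A) (X n) (X n)"
    by (rule bij_betw_translate[OF g(1)])
  have iff: "level n (g <# A) = i \<longleftrightarrow> level n A = 0" if "A \<in> X n" for A
  proof -
    have "level n (g <# A) = (i + level n A) mod 2 ^ n"
      using g that by (simp add: level_translate)
    also have "(i + level n A) mod 2 ^ n = i \<longleftrightarrow> level n A = 0"
    proof (cases "i + level n A < 2 ^ n")
      case True
      then show ?thesis
        using assms level_range[of n A] by simp
    next
      case False
      then have "(i + level n A) mod 2 ^ n = i + level n A - 2 ^ n"
        using assms level_range[of n A] mod_pos_geq[of "2 ^ n" "i + level n A"]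
          mod_pos_pos_trivial[of "i + level n A - 2 ^ n" "2 ^ n"] by simp
      then show ?thesis
        using assms level_range[of n A] False by auto
    qed
    finally show ?thesis .
  qed
  have image: "(\<lambda>A. g <# A) ` {A \<in> X n. level n A = 0} = {A \<in> X n. level n A = i}"
  proof
    show "(\<lambda>A. g <# A) ` {A \<in> X n. level n A = 0} \<subseteq> {A \<in> X n. level n A = i}"
      using iff bij_betwE[OF bij] by auto
    show "{A \<in> X n. level n A = i} \<subseteq> (\<lambda>A. g <# A) ` {A \<in> X n. level n A = 0}"
    proof
      fix B assume B: "B \<in> {A \<in> X n. level n A = i}"
      then have "B \<in> (\<lambda>A. g <# A) ` X n"
        using bij_betw_imp_surj_on[OF bij] by simp
      then obtain A where A: "A \<in> X n" "B = g <# A"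
        by (rule imageE)
      then show "B \<in> (\<lambda>A. g <# A) ` {A \<in> X n. level n A = 0}"
        using B iff by blast
    qed
  qed
  have "inj_on (\<lambda>A. g <# A) {A \<in> X n. level n A = 0}"
    using bij_betw_imp_inj_on[OF bij] by (rule inj_on_subset) auto
  from card_image[OF this] show ?thesis
    unfolding image level_size_def .
qed

lemma card_levels:
  assumes "I \<subseteq> {0..<2 ^ n}"
  shows "card {A \<in> X n. level n A \<in> I} = card I * level_size n"
proof -
  have "finite I"
    using assms finite_subset by blast
  have "{A \<in> X n. level n A \<in> I} = (\<Union>i\<in>I. {A \<in> X n. level n A = i})"
    by auto
  also have "card \<dots> = (\<Sum>i\<in>I. card {A \<in> X n. level n A = i})"
    using \<open>finite I\<close> finite_X by (intro card_UN_disjoint) auto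
  also have "\<dots> = (\<Sum>i\<in>I. level_size n)"
    using assms by (intro sum.cong refl card_level) auto
  finally show ?thesis
    by simp
qed

lemma level_size_pos: "level_size n > 0"
proof -
  have "N n #> \<one> \<in> {A \<in> X n. level n A = 0}"
    by (simp add: coset_space_eq level_coset e_one del: coset_mult_one)
  then show ?thesis
    using finite_X[of n] by (auto simp: level_size_def card_gt_0_iff)
qed

text \<open>The projection of cosets of \<open>N (Suc n)\<close> to cosets of \<open>N n\<close> maps level \<open>0\<close> onto level \<open>0\<close>:
  if \<open>e x\<close> is an odd multiple of \<open>2\<^sup>n\<close>, then multiplication by the power of \<open>a\<close> with exponent \<open>2\<^sup>n\<close>,
  which lies in \<open>N n\<close>, does not change the coset of \<open>N n\<close> but makes the multiple even.\<close>
lemma mono_level_size: "mono level_size"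
proof (rule mono_iff_le_Suc[THEN iffD2], rule allI)
  fix n
  have "{A \<in> X n. level n A = 0} \<subseteq> (\<lambda>B. N n #> rep B) ` {B \<in> X (Suc n). level (Suc n) B = 0}"
  proof
    fix A assume A: "A \<in> {A \<in> X n. level n A = 0}"
    then obtain x where x: "x \<in> carrier G" "A = N n #> x"
      by (auto simp: coset_space_eq)
    with A have "e x mod 2 ^ n = 0"
      by (simp add: level_coset)
    then obtain m where m: "e x = 2 ^ n * m"
      by (auto elim: dvdE)
    define y where "y = (if even m then x else a [^] ((2 :: nat) ^ n) \<otimes> x)"
    have y: "y \<in> carrier G"
      using x a by (simp add: y_def)
    have "N n #> y = A"
      using coset_absorb[OF pow_in_N] x by (simp add: y_def)
    moreover have "e y mod 2 ^ Suc n = 0"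
    proof (cases "even m")
      case True
      then show ?thesis
        by (auto simp: y_def m elim!: evenE)
    next
      case False
      then have "e y = 2 ^ n * (m + 1)"
        using x a by (simp add: y_def e_mult e_pow m algebra_simps)
      with False show ?thesis
        by (auto elim!: oddE)
    qed
    moreover obtain k where "k \<in> N (Suc n)" "rep (N (Suc n) #> y) = k \<otimes> y"
      using rep_coset[OF y] .
    then have "N n #> rep (N (Suc n) #> y) = N n #> y"
      using coset_absorb[of k n y] N_Suc_subset y by auto
    moreover have "N (Suc n) #> y \<in> X (Suc n)"
      using y unfolding coset_space_eq by (rule imageI)
    ultimately show "A \<in> (\<lambda>B. N n #> rep B) ` {B \<in> X (Suc n). level (Suc n) B = 0}"
      using level_coset[OF y, of "Suc n"] by (intro image_eqI[of _ _ "N (Suc n) #> y"]) auto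
  qed
  then show "level_size n \<le> level_size (Suc n)"
    unfolding level_size_def using finite_X[of "Suc n"] by (intro surj_card_le) simp_all
qed

text \<open>The interval of levels has length \<open>2\<close>\<open>\<^bsup>n div 2\<^esup>\<close>: it must tend to infinity for the Folner
  condition, and it must be negligible compared with the number \<open>2\<^sup>n\<close> of all levels.\<close>
theorem ex_growth_function_weakly_contains_trivial:
  assumes U: "nonprincipal_ultrafilter U"
  shows "\<exists>\<gamma> \<in> growth_functions G N. filterlim \<gamma> at_top sequentially \<and>
    (\<lambda>n. real (\<gamma> n) / real (card (X n))) \<longlonglongrightarrow> 0 \<and>
    weakly_contains G (H_growth G N U \<gamma>) (pi_growth G N U \<gamma>) complex_line trivial_rep"
proof -
  define L where "L = (\<lambda>n :: nat. (2 :: int) ^ (n div 2))"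
  define A where "A = (\<lambda>n. {x \<in> X n. level n x \<in> {0..<L n}})"
  define \<gamma> where "\<gamma> = (\<lambda>n. 2 ^ (n div 2) * level_size n)"
  have L: "0 < L n" "L n \<le> 2 ^ n" for n
    by (simp_all add: L_def power_increasing)
  have card_A: "card (A n) = \<gamma> n" for n
    using card_levels[of "{0..<L n}" n] L(2)[of n] by (auto simp: A_def \<gamma>_def L_def nat_power_eq)
  have card_X: "card (X n) = 2 ^ n * level_size n" for n
    using card_levels[of "{0..<2 ^ n}" n] level_range[of n] by (simp add: nat_power_eq)
  have \<gamma>_pos: "\<gamma> n > 0" for n
    using level_size_pos by (simp add: \<gamma>_def)
  have "mono \<gamma>"
    unfolding \<gamma>_def by (intro monoI mult_mono power_increasing div_le_mono monoD[OF mono_level_size]) auto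
  moreover have "\<gamma> n \<le> card (X n)" for n
    unfolding \<gamma>_def card_X by (intro mult_right_mono power_increasing) auto
  ultimately have "\<gamma> \<in> growth_functions G N"
    using \<gamma>_pos by (auto simp: growth_functions_def Suc_le_eq)
  moreover have "filterlim \<gamma> at_top sequentially"
    unfolding filterlim_at_top
  proof
    fix m :: nat
    show "\<forall>\<^sub>F n in sequentially. m \<le> \<gamma> n"
      using eventually_ge_at_top[of "2 * m"]
    proof eventually_elim
      case (elim n)
      then have "m \<le> n div 2" by simp
      also have "\<dots> \<le> 2 ^ (n div 2)"
        by (simp add: less_imp_le)
      also have "\<dots> \<le> \<gamma> n"
        using level_size_pos[of n] by (simp add: \<gamma>_def)
      finally show ?case .
    qed
  qed
  moreover have "(\<lambda>n. real (\<gamma> n) / real (card (X n))) \<longlonglongrightarrow> 0"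
  proof (rule tendsto_sandwich[OF _ _ tendsto_const power_half_tendsto_0[of 1]])
    have "real (\<gamma> n) / real (card (X n)) \<le> 1 * (1 / 2) ^ (n div 2)" for n
    proof -
      have "(2 :: real) ^ (n div 2) * 2 ^ (n div 2) \<le> 2 ^ n"
        by (simp flip: power_add)
      then show ?thesis
        using level_size_pos[of n] by (simp add: \<gamma>_def card_X field_simps)
    qed
    then show "\<forall>\<^sub>F n in sequentially. real (\<gamma> n) / real (card (X n)) \<le> 1 * (1 / 2) ^ (n div 2)"
      by simp
  qed simp
  moreover have "weakly_contains G (H_growth G N U \<gamma>) (pi_growth G N U \<gamma>) complex_line trivial_rep"
  proof (rule folner_sets_imp_weakly_contains_trivial[OF U finite_X])
    show "A n \<subseteq> X n" "card (A n) \<le> \<gamma> n" for n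
      using card_A[of n] by (auto simp: A_def)
    show "A n \<noteq> {}" for n
      using card_A[of n] \<gamma>_pos[of n] by auto
    fix g assume g: "g \<in> carrier G"
    define B where "B = (\<lambda>n. {x \<in> X n. (inv g <# x \<in> A n) \<noteq> (x \<in> A n)})"
    have "real (card (B n)) / real (card (A n)) \<le> real (nat (4 * \<bar>e g\<bar> + 2)) * (1 / 2) ^ (n div 2)" for n
    proof -
      define J where "J = {i \<in> {0..<2 ^ n}. ((i - e g) mod 2 ^ n < L n) \<noteq> (i < L n)}"
      have "B n = {x \<in> X n. level n x \<in> J}"
        using g level_range[of n] bij_betwE[OF bij_betw_translate[of "inv g" n]]
        by (auto simp: B_def A_def J_def level_translate e_inv)
      moreover have "J \<subseteq> {0..<2 ^ n}"
        by (auto simp: J_def)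
      ultimately have "card (B n) = card J * level_size n"
        by (simp add: card_levels)
      also have "\<dots> \<le> nat (4 * \<bar>e g\<bar> + 2) * level_size n"
        unfolding J_def by (intro mult_right_mono card_shift_symmetric_difference L) simp
      finally have "real (card (B n)) \<le> real (nat (4 * \<bar>e g\<bar> + 2)) * real (level_size n)"
        by (metis of_nat_le_iff of_nat_mult)
      then show ?thesis
        using level_size_pos[of n] by (simp add: card_A \<gamma>_def power_divide field_simps)
    qed
    then show "(\<lambda>n. real (card {x \<in> X n. (inv g <# x \<in> A n) \<noteq> (x \<in> A n)}) / real (card (A n))) \<longlonglongrightarrow> 0"
      unfolding B_def
      by (intro tendsto_sandwich[OF _ _ tendsto_const
            power_half_tendsto_0[of "real (nat (4 * \<bar>e g\<bar> + 2))"]]) simp_all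
  qed
  ultimately show ?thesis
    by blast
qed

end

section \<open>The free group on two generators\<close>

definition exponent_sum_of_True :: "bool letter list \<Rightarrow> int" where
  "exponent_sum_of_True w = (\<Sum>(s, p)\<leftarrow>w. if s then (if p then 1 else - 1) else 0)"

text \<open>A letter and its inverse contribute opposite amounts, so cancellation does not change the sum.\<close>
lemma exponent_sum_of_True_foldr_push:
  "exponent_sum_of_True (foldr push u v) = exponent_sum_of_True u + exponent_sum_of_True v"
proof -
  have push: "exponent_sum_of_True (push x w) = exponent_sum_of_True [x] + exponent_sum_of_True w" for x w
    by (cases x; cases w) (auto simp: exponent_sum_of_True_def inv_letter_def split: if_splits)
  show ?thesis
  proof (induction u)
    case (Cons x u)
    then show ?case
      using push[of x "foldr push u v"] by (simp add: exponent_sum_of_True_def)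
  qed (simp add: exponent_sum_of_True_def)
qed

lemma generate_F2: "generate F2 (range (\<lambda>x. [x])) = carrier F2"
proof
  interpret group F2 by (rule group_F2)
  have letters: "range (\<lambda>x. [x]) \<subseteq> carrier F2"
    by (auto simp: F2_def free_group_def reduced_def)
  show "generate F2 (range (\<lambda>x. [x])) \<subseteq> carrier F2"
    by (rule generate_incl[OF letters])
  show "carrier F2 \<subseteq> generate F2 (range (\<lambda>x. [x]))"
  proof
    fix w :: "bool letter list" assume "w \<in> carrier F2"
    then have "reduced w"
      by (simp add: F2_def free_group_def)
    then show "w \<in> generate F2 (range (\<lambda>x. [x]))"
    proof (induction w)
      case Nil
      show ?case
        using generate.one[of F2] by (simp add: F2_def free_group_def)
    next
      case (Cons x w)
      from Cons.prems have "reduced w"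
        by (cases w) (simp_all add: reduced_def)
      from Cons.prems have push: "push x w = x # w"
        by (cases w) (simp_all add: reduced_def)
      have "[x] \<otimes>\<^bsub>F2\<^esub> w \<in> generate F2 (range (\<lambda>x. [x]))"
        using Cons.IH[OF \<open>reduced w\<close>] by (rule generate.eng[OF generate.incl[OF rangeI]])
      with push show ?case
        by (simp add: F2_def free_group_def)
    qed
  qed
qed

theorem theorem6p3:
  fixes U :: "nat filter"
  assumes "nonprincipal_ultrafilter U"
  shows "\<exists>\<gamma> \<in> growth_functions F2 (squares_series F2).
    filterlim \<gamma> at_top sequentially \<and>
    (\<lambda>n. real (\<gamma> n) / real (card (coset_space F2 (squares_series F2) n))) \<longlonglongrightarrow> 0 \<and>
    weakly_contains F2
      (H_growth F2 (squares_series F2) U \<gamma>) (pi_growth F2 (squares_series F2) U \<gamma>)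
      complex_line trivial_rep"
proof -
  interpret fg_group_onto_int F2 "range (\<lambda>x. [x])" exponent_sum_of_True "[(True, True)]"
  proof (intro fg_group_onto_int.intro fg_group_onto_int_axioms.intro group_F2)
    show "exponent_sum_of_True (u \<otimes>\<^bsub>F2\<^esub> v) = exponent_sum_of_True u + exponent_sum_of_True v" for u v
      by (simp add: F2_def free_group_def exponent_sum_of_True_foldr_push)
  qed (auto simp: generate_F2 exponent_sum_of_True_def, auto simp: F2_def free_group_def reduced_def)
  show ?thesis
    by (rule ex_growth_function_weakly_contains_trivial[OF assms])
qed

end
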